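(* Suppose that $n\ge3$, $0<m<\frac{n-2}{n}$ and $\mu_0>0$. Let $\mu_0\le u_0\in L^p_{loc}(\widehat{\mathbb{R}^n})$ for some constant $p>\frac{n(1-m)}{2}$ satisfy $$u_0(x)\ge\frac{\lambda_i}{|x-a_i|^{\gamma_i}}\qquad\forall\,0<|x-a_i|<\delta_1,\ i=1,\dots,i_0,$$ for some constants $0<\delta_1<\delta_0$, $\lambda_1,\dots,\lambda_{i_0}>0$ and $$\gamma_1>\frac{n-2}{m},\qquad\gamma_i>\frac{2}{1-m}\quad\forall i=2,\dots,i_0.$$ Let $u$ be the constructed solution (defined in the context) of $$\begin{cases}u_t=\Delta u^m & \text{in }\widehat{\mathbb{R}^n}\times(0,\infty)\\ u(a_i,t)=\infty & \forall i=1,\dots,i_0,\ t>0\\ u(x,0)=u_0(x) & \text{in }\widehat{\mathbb{R}^n}.\end{cases}$$ Then $u(x,t)\to\infty$ uniformly on $K$ as $t\to\infty$ for any compact subset $K$ of $\widehat{\mathbb{R}^n}$.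
   Context: $a_1,\dots,a_{i_0}\in\mathbb{R}^n$ are distinct points, $\widehat{\mathbb{R}^n}=\mathbb{R}^n\setminus\{a_1,\dots,a_{i_0}\}$, and $\delta_0=\frac13\min_{i\neq j}|a_i-a_j|$ (with $\delta_0=+\infty$ if $i_0=1$). A solution $u$ of the problem in the claim is a function $u$, positive in $\widehat{\mathbb{R}^n}\times(0,\infty)$, satisfying $u_t=\Delta u^m$ there in the classical sense, such that $\|u(\cdot,t)-u_0\|_{L^1(K)}\to0$ as $t\to0$ for any compact $K\subset\widehat{\mathbb{R}^n}$, and $u(x,t)\to\infty$ as $x\to a_i$ for every $t>0$ and $i=1,\dots,i_0$. The constructed solution (the one given by the paper's existence theorem). For $0<\varepsilon<1$, $M>1$ let $u_{\varepsilon,M}$ be the unique positive classical solution of $u_t=\Delta u^m$ in $\mathbb{R}^n\times(0,\infty)$ with initial value $\min(u_0(x),M)+\varepsilon$ (attained in $L^1_{loc}(\mathbb{R}^n)$ as $t\to0$) satisfying $\varepsilon\le u_{\varepsilon,M}\le M+\varepsilon$. The functions $u_{\varepsilon,M}$ are monotone in $\varepsilon$ and $M$, and the constructed solution is $u(x,t)=\lim_{M\to\infty}\lim_{\varepsilon\to0}u_{\varepsilon,M}(x,t)$, $x\in\widehat{\mathbb{R}^n}$, $t>0$. *)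

theory Defs
  imports "HOL-Analysis.Analysis"
begin

definition partial_deriv :: "'a::euclidean_space \<Rightarrow> ('a \<Rightarrow> real) \<Rightarrow> 'a \<Rightarrow> real" where
  "partial_deriv b f x = deriv (\<lambda>s. f (x + s *\<^sub>R b)) 0"

text \<open>Meaningful only where the second partial derivatives exist (\<^const>\<open>deriv\<close> is a choice
  operator); it is used below only for functions that are twice continuously differentiable in space.\<close>

definition laplacian :: "('a::euclidean_space \<Rightarrow> real) \<Rightarrow> 'a \<Rightarrow> real" where
  "laplacian f x = (\<Sum>b\<in>Basis. partial_deriv b (partial_deriv b f) x)"

text \<open>The class $C^{2,1}(\Omega\times(0,\infty))$, for open \<open>\<Omega>\<close>: \<open>ut\<close>, \<open>Du b\<close>, \<open>D2u b c\<close> are the time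
  derivative and the first and second (including mixed) space derivatives.\<close>

definition C21_on :: "'a::euclidean_space set \<Rightarrow> ('a \<Rightarrow> real \<Rightarrow> real) \<Rightarrow> bool" where
  "C21_on \<Omega> u \<longleftrightarrow> (\<exists>ut Du D2u.
     (\<forall>x\<in>\<Omega>. \<forall>t>0.
        ((\<lambda>s. u x s) has_real_derivative ut x t) (at t) \<and>
        (\<forall>b\<in>Basis. ((\<lambda>s. u (x + s *\<^sub>R b) t) has_real_derivative Du b x t) (at 0)) \<and>
        (\<forall>b\<in>Basis. \<forall>c\<in>Basis.
           ((\<lambda>s. Du b (x + s *\<^sub>R c) t) has_real_derivative D2u b c x t) (at 0))) \<and>
     continuous_on (\<Omega> \<times> {0<..}) (\<lambda>(x, t). u x t) \<and>
     continuous_on (\<Omega> \<times> {0<..}) (\<lambda>(x, t). ut x t) \<and>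
     (\<forall>b\<in>Basis. continuous_on (\<Omega> \<times> {0<..}) (\<lambda>(x, t). Du b x t)) \<and>
     (\<forall>b\<in>Basis. \<forall>c\<in>Basis. continuous_on (\<Omega> \<times> {0<..}) (\<lambda>(x, t). D2u b c x t)))"

definition positive_classical_solution ::
    "real \<Rightarrow> 'a::euclidean_space set \<Rightarrow> ('a \<Rightarrow> real \<Rightarrow> real) \<Rightarrow> bool" where
  "positive_classical_solution m \<Omega> u \<longleftrightarrow>
     (\<forall>x\<in>\<Omega>. \<forall>t>0. 0 < u x t) \<and>
     C21_on \<Omega> u \<and>
     (\<forall>x\<in>\<Omega>. \<forall>t>0. deriv (\<lambda>s. u x s) t = laplacian (\<lambda>y. u y t powr m) x)"

definition attains_initial_L1loc ::
    "'a::euclidean_space set \<Rightarrow> ('a \<Rightarrow> real \<Rightarrow> real) \<Rightarrow> ('a \<Rightarrow> real) \<Rightarrow> bool" where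
  "attains_initial_L1loc \<Omega> u g \<longleftrightarrow>
     (\<forall>K. compact K \<and> K \<subseteq> \<Omega> \<longrightarrow>
        ((\<lambda>t. \<integral>\<^sup>+x. ennreal \<bar>u x t - g x\<bar> \<partial>(lebesgue_on K)) \<longlongrightarrow> 0) (at_right 0))"

definition Lp_loc :: "real \<Rightarrow> 'a::euclidean_space set \<Rightarrow> ('a \<Rightarrow> real) \<Rightarrow> bool" where
  "Lp_loc p \<Omega> f \<longleftrightarrow>
     f \<in> borel_measurable (lebesgue_on \<Omega>) \<and>
     (\<forall>K. compact K \<and> K \<subseteq> \<Omega> \<longrightarrow> integrable (lebesgue_on K) (\<lambda>x. \<bar>f x\<bar> powr p))"

definition punctured :: "(nat \<Rightarrow> 'a::euclidean_space) \<Rightarrow> nat \<Rightarrow> 'a set" where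
  "punctured a k = UNIV - a ` {1..k}"

definition delta0 :: "(nat \<Rightarrow> 'a::euclidean_space) \<Rightarrow> nat \<Rightarrow> ereal" where
  "delta0 a k =
     (if k = 1 then \<infinity>
      else ereal (1/3 * Min {norm (a i - a j) | i j. i \<in> {1..k} \<and> j \<in> {1..k} \<and> i \<noteq> j}))"

definition blow_up_solution ::
    "real \<Rightarrow> (nat \<Rightarrow> 'a::euclidean_space) \<Rightarrow> nat \<Rightarrow> ('a \<Rightarrow> real) \<Rightarrow> ('a \<Rightarrow> real \<Rightarrow> real) \<Rightarrow> bool" where
  "blow_up_solution m a k u0 u \<longleftrightarrow>
     positive_classical_solution m (punctured a k) u \<and>
     attains_initial_L1loc (punctured a k) u u0 \<and>
     (\<forall>t>0. \<forall>i\<in>{1..k}. filterlim (\<lambda>x. u x t) at_top (at (a i)))"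

definition approx_solution ::
    "real \<Rightarrow> ('a::euclidean_space \<Rightarrow> real) \<Rightarrow> real \<Rightarrow> real \<Rightarrow> ('a \<Rightarrow> real \<Rightarrow> real) \<Rightarrow> bool" where
  "approx_solution m u0 \<epsilon> M v \<longleftrightarrow>
     positive_classical_solution m UNIV v \<and>
     attains_initial_L1loc UNIV v (\<lambda>x. min (u0 x) M + \<epsilon>) \<and>
     (\<forall>x. \<forall>t>0. \<epsilon> \<le> v x t \<and> v x t \<le> M + \<epsilon>)"

text \<open>\<open>U \<epsilon> M\<close> is the approximating solution $u_{\varepsilon,M}$, which is determined uniquely on
  positive times by \<^const>\<open>approx_solution\<close>, and \<open>V M\<close> is its limit as $\varepsilon\to0$. Uniqueness and
  monotonicity in $\varepsilon$, $M$ are theorems about $u_{\varepsilon,M}$ and are not assumed here.\<close>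

definition constructed_solution ::
    "real \<Rightarrow> (nat \<Rightarrow> 'a::euclidean_space) \<Rightarrow> nat \<Rightarrow> ('a \<Rightarrow> real) \<Rightarrow> ('a \<Rightarrow> real \<Rightarrow> real) \<Rightarrow> bool" where
  "constructed_solution m a k u0 u \<longleftrightarrow>
     blow_up_solution m a k u0 u \<and>
     (\<exists>U V.
        (\<forall>\<epsilon> M. 0 < \<epsilon> \<and> \<epsilon> < 1 \<and> 1 < M \<longrightarrow> approx_solution m u0 \<epsilon> M (U \<epsilon> M)) \<and>
        (\<forall>x\<in>punctured a k. \<forall>t>0.
           (\<forall>M>1. ((\<lambda>\<epsilon>. U \<epsilon> M x t) \<longlongrightarrow> V M x t) (at_right 0)) \<and>
           ((\<lambda>M. V M x t) \<longlongrightarrow> u x t) at_top))"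

end

theory Submission
  imports Defs
begin

text \<open>
  Only the singularity at \<open>a 1\<close> matters. If an approximating solution starts above a constant \<open>H\<close> on a
  ball of radius \<open>r\<close>, an explicit decaying subsolution in that ball keeps it above a multiple of \<open>H\<close> on
  the half ball for a time \<open>T\<close> comparable to \<open>H\<^sup>1\<^sup>-\<^sup>m r\<^sup>2\<close>. This feeds a second explicit subsolution,
  vanishing initially and increasing in time, which fills the exterior with the harmonic tail of the
  fast diffusion equation: at time \<open>T\<close> the solution is at least a multiple of
  \<open>H\<close> times \<open>(\<bar>x - a 1\<bar> / r)\<close> to the power \<open>-(n - 2) / m\<close>. Both bounds are independent of
  $\varepsilon$ and $M$. Since $u_0$ exceeds \<open>H\<close>, taken to be \<open>lam 1\<close> times \<open>r\<close> to the power
  \<open>-\<gamma> 1\<close>, near \<open>a 1\<close>, letting \<open>r\<close> tend to \<open>0\<close> makes \<open>T\<close> range over all large times because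
  \<open>\<gamma> 1 > 2 / (1 - m)\<close>, and makes the lower bound tend to infinity on compact sets because
  \<open>\<gamma> 1 > (n - 2) / m\<close>. Comparison with initial data attained only in $L^1_{loc}$ rests on Kato's
  inequality: the integral of the positive part of subsolution minus solution does not increase.
\<close>

subsection \<open>Kato's inequality and comparison\<close>

lemma has_real_derivative_shift_line:
  fixes f :: "'a::real_normed_vector \<Rightarrow> real"
  assumes "((\<lambda>s. f (x + h *\<^sub>R b + s *\<^sub>R b)) has_real_derivative d) (at 0)"
  shows "((\<lambda>s. f (x + s *\<^sub>R b)) has_real_derivative d) (at h)"
proof -
  have "((\<lambda>s. f (x + (s + h) *\<^sub>R b)) has_real_derivative d) (at 0)"
    using assms by (simp add: scaleR_add_left algebra_simps)
  then show ?thesis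
    using DERIV_shift[of "\<lambda>s. f (x + s *\<^sub>R b)" d 0 h] by simp
qed

text \<open>By translation invariance every difference quotient has integral zero.\<close>

lemma integral_directional_derivative_eq_0:
  fixes f f' :: "'a::euclidean_space \<Rightarrow> real"
  assumes K: "compact K"
    and f0: "\<And>x. x \<notin> K \<Longrightarrow> f x = 0" and f'0: "\<And>x. x \<notin> K \<Longrightarrow> f' x = 0"
    and cf: "continuous_on UNIV f" and cf': "continuous_on UNIV f'"
    and deriv: "\<And>x. ((\<lambda>s. f (x + s *\<^sub>R b)) has_real_derivative f' x) (at 0)"
  shows "integrable lborel f'" and "integral\<^sup>L lborel f' = 0"
proof -
  have int: "integrable lborel g" if "continuous_on UNIV g" "\<And>x. x \<notin> K \<Longrightarrow> g x = 0" for g :: "'a \<Rightarrow> real"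
  proof -
    have "integrable lborel (\<lambda>x. indicator K x *\<^sub>R g x)"
      by (rule borel_integrable_compact[OF K]) (use that continuous_on_subset in blast)
    moreover have "(\<lambda>x. indicator K x *\<^sub>R g x) = g"
      using that by (auto simp: fun_eq_iff indicator_def)
    ultimately show ?thesis by simp
  qed
  show "integrable lborel f'" by (rule int[OF cf' f'0])
  have fint: "integrable lborel f" by (rule int[OF cf f0])
  have [measurable]: "f \<in> borel_measurable borel" "f' \<in> borel_measurable borel"
    using cf cf' by (auto intro: borel_measurable_continuous_onI)
  \<comment> \<open>\<open>S\<close> contains every point from which a step
    \<open>h *\<^sub>R b\<close> with h in [0, 1] can land in \<open>K\<close>. All quotients
    \<open>D i\<close> therefore vanish outside this one compact set, and a multiple of its
    indicator dominates them.\<close>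
  define S where "S = {x + y |x y. x \<in> K \<and> y \<in> closed_segment 0 (- b)}"
  have S: "compact S" unfolding S_def by (rule compact_sums[OF K compact_segment])
  have inS: "x \<in> S" if "x + h *\<^sub>R b \<in> K" "0 \<le> h" "h \<le> 1" for x h
  proof -
    have "- (h *\<^sub>R b) \<in> closed_segment 0 (- b)"
      unfolding closed_segment_def using that by (intro CollectI exI[of _ h]) auto
    moreover have "x = (x + h *\<^sub>R b) + (- (h *\<^sub>R b))" by simp
    ultimately show ?thesis unfolding S_def using that(1) by blast
  qed
  obtain C where C: "\<And>x. x \<in> K \<Longrightarrow> \<bar>f' x\<bar> \<le> C" "C \<ge> 0"
  proof -
    have "bounded (f' ` K)"
      by (intro compact_imp_bounded compact_continuous_image K continuous_on_subset[OF cf']) auto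
    then show thesis
      using that unfolding bounded_pos by (metis imageI less_imp_le real_norm_def)
  qed
  have C': "\<bar>f' x\<bar> \<le> C" for x
    using C f'0[of x] by (cases "x \<in> K") auto
  define D where "D = (\<lambda>i x. (f (x + (1 / real (Suc i)) *\<^sub>R b) - f x) * real (Suc i))"
  have bound: "norm (D i x) \<le> indicator S x * C" for i x
  proof (cases "x \<in> S")
    case True
    \<comment> \<open>By the mean value theorem the quotient is a value of \<open>f'\<close>, hence
      bounded by \<open>C\<close> uniformly in \<open>i\<close>.\<close>
    have "\<exists>l>0. l < 1 / real (Suc i) \<and>
        f (x + (1 / real (Suc i)) *\<^sub>R b) - f (x + 0 *\<^sub>R b) = (1 / real (Suc i) - 0) * f' (x + l *\<^sub>R b)"
      using MVT2[of 0 "1 / real (Suc i)" "\<lambda>s. f (x + s *\<^sub>R b)" "\<lambda>s. f' (x + s *\<^sub>R b)"]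
        has_real_derivative_shift_line[OF deriv] by auto
    then obtain l where "f (x + (1 / real (Suc i)) *\<^sub>R b) - f x = (1 / real (Suc i)) * f' (x + l *\<^sub>R b)"
      by auto
    then have "D i x = f' (x + l *\<^sub>R b)" by (simp add: D_def)
    then show ?thesis using True C' by simp
  next
    case False
    have "x \<notin> K" using inS[of x 0] False by auto
    moreover have "x + (1 / real (Suc i)) *\<^sub>R b \<notin> K" using inS[of x "1 / real (Suc i)"] False by auto
    ultimately show ?thesis using f0 False by (simp add: D_def)
  qed
  have lim: "(\<lambda>i. D i x) \<longlonglongrightarrow> f' x" for x
  proof -
    have "((\<lambda>h. (f (x + h *\<^sub>R b) - f x) / h) \<longlongrightarrow> f' x) (at 0)"
      using deriv[of x] by (simp add: DERIV_def)
    moreover have "filterlim (\<lambda>i. 1 / real (Suc i)) (at 0) sequentially"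
      unfolding filterlim_at using LIMSEQ_inverse_real_of_nat by (auto simp: inverse_eq_divide)
    ultimately have "((\<lambda>i. (f (x + (1 / real (Suc i)) *\<^sub>R b) - f x) / (1 / real (Suc i))) \<longlongrightarrow> f' x) sequentially"
      by (rule filterlim_compose)
    then show ?thesis by (simp add: D_def)
  qed
  have "(\<lambda>i. integral\<^sup>L lborel (D i)) \<longlonglongrightarrow> integral\<^sup>L lborel f'"
  proof (rule integral_dominated_convergence[where w = "\<lambda>x. indicator S x * C"])
    show "integrable lborel (\<lambda>x. indicator S x * C)"
      using borel_integrable_compact[OF S continuous_on_const[of S C]] by simp
    show "D i \<in> borel_measurable lborel" for i unfolding D_def by measurable
  qed (use lim bound in auto)
  moreover have "integral\<^sup>L lborel (D i) = 0" for i
  proof -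
    have sh: "integral\<^sup>L lborel (\<lambda>x. f (x + c)) = integral\<^sup>L lborel f"
         "integrable lborel (\<lambda>x. f (x + c))" for c
    proof -
      have *: "lborel = distr lborel borel ((+) c)" using lborel_distr_plus[of c] by simp
      show "integral\<^sup>L lborel (\<lambda>x. f (x + c)) = integral\<^sup>L lborel f"
        by (subst (2) *, subst integral_distr) (auto simp: add.commute)
      have "integrable (distr lborel borel ((+) c)) f" using fint * by simp
      then show "integrable lborel (\<lambda>x. f (x + c))"
        by (subst (asm) integrable_distr_eq) (auto simp: add.commute)
    qed
    show ?thesis unfolding D_def using sh fint by simp
  qed
  ultimately show "integral\<^sup>L lborel f' = 0" by (simp add: LIMSEQ_const_iff)
qed

section \<open>A C^1 approximation of the indicator of the positive half line\<close>

text \<open>For s > 0 this is k s^2 / (1 + k s^2). Squaring the positive part removes the corner at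
  0, and one continuous derivative is enough because the function is differentiated only
  once.\<close>

definition smooth_step :: "nat \<Rightarrow> real \<Rightarrow> real" where
  "smooth_step k s = 1 - 1 / (1 + real k * (max 0 s)\<^sup>2)"

definition smooth_step' :: "nat \<Rightarrow> real \<Rightarrow> real" where
  "smooth_step' k s = 2 * real k * max 0 s / (1 + real k * (max 0 s)\<^sup>2)\<^sup>2"

lemma max0_square_deriv: "((\<lambda>s::real. (max 0 s)\<^sup>2) has_real_derivative 2 * max 0 s) (at s)"
proof -
  consider "s < 0" | "s = 0" | "s > 0" by linarith
  then show ?thesis
  proof cases
    case 1
    have "((\<lambda>s::real. 0) has_real_derivative 2 * max 0 s) (at s)" using 1 by simp
    then show ?thesis
      by (rule has_field_derivative_transform_within_open[where S="{..<0}"]) (use 1 in auto)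
  next
    case 3
    have "((\<lambda>s::real. s\<^sup>2) has_real_derivative 2 * max 0 s) (at s)"
      using 3 by (auto intro!: derivative_eq_intros)
    then show ?thesis
      by (rule has_field_derivative_transform_within_open[where S="{0<..}"]) (use 3 in auto)
  next
    case 2
    have "((\<lambda>h::real. (max 0 h)\<^sup>2 / h) \<longlongrightarrow> 0) (at 0)"
    proof (rule tendsto_rabs_zero_cancel, rule tendsto_sandwich[where f="\<lambda>_. 0" and h="\<lambda>h. \<bar>h\<bar>"])
      show "\<forall>\<^sub>F h::real in at 0. \<bar>(max 0 h)\<^sup>2 / h\<bar> \<le> \<bar>h\<bar>"
        by (intro always_eventually allI) (auto simp: max_def power2_eq_square)
      show "((\<lambda>h::real. \<bar>h\<bar>) \<longlongrightarrow> 0) (at 0)" by (rule tendsto_rabs_zero) simp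
    qed auto
    then show ?thesis using 2 by (simp add: DERIV_def)
  qed
qed

lemma smooth_step_deriv: "(smooth_step k has_real_derivative smooth_step' k s) (at s)"
proof -
  have "1 + real k * (max 0 s)\<^sup>2 > 0" by (simp add: add_pos_nonneg)
  then have "((\<lambda>y. 1 - 1 / (1 + real k * y)) has_real_derivative
      real k / (1 + real k * (max 0 s)\<^sup>2)\<^sup>2) (at ((max 0 s)\<^sup>2))"
    by (auto intro!: derivative_eq_intros simp: power2_eq_square)
  from DERIV_chain2[OF this max0_square_deriv] show ?thesis
    unfolding smooth_step_def smooth_step'_def by (simp add: mult_ac)
qed

lemma smooth_step_bounds: "0 \<le> smooth_step k s" "smooth_step k s \<le> 1" "0 \<le> smooth_step' k s"
proof -
  have "1 / (1 + real k * (max 0 s)\<^sup>2) \<le> 1" by (subst divide_le_eq_1) (simp add: add_pos_nonneg)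
  then show "0 \<le> smooth_step k s" "smooth_step k s \<le> 1" "0 \<le> smooth_step' k s"
    unfolding smooth_step_def smooth_step'_def by simp_all
qed

lemma smooth_step_nonpos: "s \<le> 0 \<Longrightarrow> smooth_step k s = 0" "s \<le> 0 \<Longrightarrow> smooth_step' k s = 0"
  by (auto simp: smooth_step_def smooth_step'_def max_def)

lemma continuous_smooth_step:
  "continuous_on S (smooth_step k)" "continuous_on S (smooth_step' k)"
proof -
  have "1 + real k * (max 0 s)\<^sup>2 \<noteq> 0" for s
    using zero_le_power2[of "max 0 s"] mult_nonneg_nonneg[of "real k" "(max 0 s)\<^sup>2"] by linarith
  then show "continuous_on S (smooth_step k)" "continuous_on S (smooth_step' k)"
    unfolding smooth_step_def smooth_step'_def by (auto intro!: continuous_intros)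
qed

lemma smooth_step_tendsto: "(\<lambda>k. smooth_step k s) \<longlonglongrightarrow> (if s > 0 then 1 else 0)"
proof (cases "s > 0")
  case True
  have "filterlim (\<lambda>k. 1 + s\<^sup>2 * real k) at_top sequentially"
    using True by (intro filterlim_tendsto_add_at_top[OF tendsto_const]
      filterlim_tendsto_pos_mult_at_top[OF tendsto_const] filterlim_real_sequentially) auto
  then have "(\<lambda>k. 1 - 1 / (1 + s\<^sup>2 * real k)) \<longlonglongrightarrow> 1 - 0"
    by (intro tendsto_diff tendsto_const tendsto_divide_0[OF tendsto_const] filterlim_at_top_imp_at_infinity)
  then show ?thesis using True by (simp add: smooth_step_def max_def mult.commute)
next
  case False
  then show ?thesis by (simp add: smooth_step_nonpos)
qed

section \<open>Kato's inequality in integrated form\<close>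

lemma continuous_on_zero_extension:
  fixes h :: "'a::topological_space \<Rightarrow> real"
  assumes "open \<Omega>" "closed K" "K \<subseteq> \<Omega>" "continuous_on \<Omega> h" "\<And>x. x \<in> \<Omega> - K \<Longrightarrow> h x = 0"
  shows "continuous_on UNIV (\<lambda>x. if x \<in> \<Omega> then h x else 0)"
proof -
  let ?f = "\<lambda>x. if x \<in> \<Omega> then h x else 0"
  have "continuous_on \<Omega> ?f"
    using assms(4) by (rule continuous_on_eq) simp
  moreover have "continuous_on (- K) ?f"
    by (rule continuous_on_eq[of _ "\<lambda>_. 0"]) (use assms in auto)
  ultimately have "continuous_on (\<Omega> \<union> - K) ?f"
    using assms by (intro continuous_on_open_Un) auto
  moreover have "\<Omega> \<union> - K = UNIV" using assms by auto
  ultimately show ?thesis by simp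
qed

text \<open>The weight \<open>smooth_step k (z x)\<close> vanishes on \<open>\<Omega> - K\<close>,
  so the product of weight and \<open>D b\<close> has compact support and its derivative in
  direction \<open>b\<close> integrates to zero. That derivative is the weight times
  \<open>DD b\<close> plus the nonnegative term
  \<open>smooth_step' k (z x) * (D b x)\<^sup>2\<close>. Hence the weighted integral of the
  Laplacian, and of \<open>q\<close> below it, is at most zero, and as \<open>k\<close> tends to
  infinity the weight becomes the indicator of the set where \<open>z\<close> is positive.\<close>

lemma kato_integral_nonpos:
  fixes z q :: "'a::euclidean_space \<Rightarrow> real"
  assumes \<Omega>: "open \<Omega>" and K: "compact K" "K \<subseteq> \<Omega>"
    and cz: "continuous_on \<Omega> z"
    and cD: "\<And>b. b \<in> Basis \<Longrightarrow> continuous_on \<Omega> (D b)"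
    and cD2: "\<And>b. b \<in> Basis \<Longrightarrow> continuous_on \<Omega> (DD b)"
    and d1: "\<And>x b. x \<in> \<Omega> \<Longrightarrow> b \<in> Basis \<Longrightarrow> ((\<lambda>s. z (x + s *\<^sub>R b)) has_real_derivative D b x) (at 0)"
    and d2: "\<And>x b. x \<in> \<Omega> \<Longrightarrow> b \<in> Basis \<Longrightarrow> ((\<lambda>s. D b (x + s *\<^sub>R b)) has_real_derivative DD b x) (at 0)"
    and off: "\<And>x. x \<in> \<Omega> - K \<Longrightarrow> z x \<le> 0"
    and cq: "continuous_on K q"
    and q: "\<And>x. x \<in> K \<Longrightarrow> q x \<le> (\<Sum>b\<in>Basis. DD b x)"
  shows "integrable lborel (\<lambda>x. indicator K x * (if z x > 0 then q x else 0))"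
    and "(\<integral>x. indicator K x * (if z x > 0 then q x else 0) \<partial>lborel) \<le> 0"
proof -
  have clK: "closed K" using K by (simp add: compact_imp_closed)
  have cz': "continuous_on K z" using cz K continuous_on_subset by blast
  have gint: "integrable lborel (\<lambda>x. indicator K x * (smooth_step k (z x) * h x))"
    if "continuous_on K h" for k h
  proof -
    have "continuous_on K (\<lambda>x. smooth_step k (z x) * h x)"
      by (intro continuous_on_mult that continuous_on_compose2[OF continuous_smooth_step(1) cz' subset_UNIV])
    from borel_integrable_compact[OF K(1) this] show ?thesis by simp
  qed
  have one: "(\<integral>x. indicator K x * (smooth_step k (z x) * DD b x) \<partial>lborel) \<le> 0" if b: "b \<in> Basis" for k b
  proof -
    define f where "f = (\<lambda>x. if x \<in> \<Omega> then smooth_step k (z x) * D b x else 0)"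
    define f' where "f' = (\<lambda>x. if x \<in> \<Omega> then
      smooth_step' k (z x) * (D b x)\<^sup>2 + smooth_step k (z x) * DD b x else 0)"
    have f0: "f x = 0" if "x \<notin> K" for x using that off[of x] by (auto simp: f_def smooth_step_nonpos)
    have f'0: "f' x = 0" if "x \<notin> K" for x using that off[of x] by (auto simp: f'_def smooth_step_nonpos)
    note cs = continuous_on_compose2[OF continuous_smooth_step(1) cz subset_UNIV]
      continuous_on_compose2[OF continuous_smooth_step(2) cz subset_UNIV]
    have cf: "continuous_on UNIV f" unfolding f_def
      by (rule continuous_on_zero_extension[OF \<Omega> clK K(2)])
        (auto intro!: continuous_on_mult cs cD b simp: smooth_step_nonpos off)
    have cf': "continuous_on UNIV f'" unfolding f'_def
      by (rule continuous_on_zero_extension[OF \<Omega> clK K(2)])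
        (auto intro!: continuous_intros cs cD cD2 b simp: smooth_step_nonpos off)
    have op: "open {s::real. x + s *\<^sub>R b \<in> S}" if "open S" for x S
      using that by (intro open_vimage[unfolded vimage_def]) (auto intro!: continuous_intros)
    have df: "((\<lambda>s. f (x + s *\<^sub>R b)) has_real_derivative f' x) (at 0)" for x
    proof (cases "x \<in> \<Omega>")
      case True
      have s: "((\<lambda>s. smooth_step k (z (x + s *\<^sub>R b))) has_real_derivative
          smooth_step' k (z x) * D b x) (at 0)"
        using DERIV_chain2[OF _ d1[OF True b]] smooth_step_deriv by force
      have "((\<lambda>s. smooth_step k (z (x + s *\<^sub>R b)) * D b (x + s *\<^sub>R b)) has_real_derivative f' x) (at 0)"
        using DERIV_mult[OF s d2[OF True b]] True by (simp add: f'_def power2_eq_square algebra_simps)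
      then show ?thesis
        by (rule has_field_derivative_transform_within_open[OF _ op[OF \<Omega>, of x]])
          (use True in \<open>auto simp: f_def\<close>)
    next
      case False
      \<comment> \<open>Points outside \<open>\<Omega>\<close> lie in the open set
        \<open>- K\<close>, on which the extension vanishes identically, so its derivative there is
        zero.\<close>
      then have "x \<notin> K" using K by auto
      have "((\<lambda>s. 0) has_real_derivative f' x) (at 0)" using False by (simp add: f'_def)
      then show ?thesis
        by (rule has_field_derivative_transform_within_open[OF _ op[of "- K" x]])
          (use \<open>x \<notin> K\<close> clK f0 in auto)
    qed
    note I = integral_directional_derivative_eq_0[OF K(1) f0 f'0 cf cf' df]
    have "(\<integral>x. indicator K x * (smooth_step k (z x) * DD b x) \<partial>lborel) \<le> integral\<^sup>L lborel f'"
    proof (rule integral_mono[OF gint I(1)])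
      show "continuous_on K (DD b)" using cD2[OF b] K continuous_on_subset by blast
      show "indicat_real K x * (smooth_step k (z x) * DD b x) \<le> f' x" for x
        using f'0[of x] K smooth_step_bounds(3)[of k "z x"] by (cases "x \<in> K") (auto simp: f'_def)
    qed
    then show ?thesis using I(2) by simp
  qed
  have step: "(\<integral>x. indicator K x * (smooth_step k (z x) * q x) \<partial>lborel) \<le> 0" for k
  proof -
    have iD: "integrable lborel (\<lambda>x. indicator K x * (smooth_step k (z x) * DD b x))" if "b \<in> Basis" for b
      using cD2[OF that] K continuous_on_subset gint by blast
    have "(\<integral>x. indicator K x * (smooth_step k (z x) * q x) \<partial>lborel) \<le>
        (\<integral>x. (\<Sum>b\<in>Basis. indicator K x * (smooth_step k (z x) * DD b x)) \<partial>lborel)"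
    proof (rule integral_mono[OF gint[OF cq]])
      show "indicat_real K x * (smooth_step k (z x) * q x)
          \<le> (\<Sum>b\<in>Basis. indicat_real K x * (smooth_step k (z x) * DD b x))" for x
        using q[of x] smooth_step_bounds(1)[of k "z x"]
        by (auto simp: indicator_def sum_distrib_left[symmetric] mult_left_mono)
    qed (rule Bochner_Integration.integrable_sum[OF iD])
    also have "\<dots> = (\<Sum>b\<in>Basis. \<integral>x. indicator K x * (smooth_step k (z x) * DD b x) \<partial>lborel)"
      using iD by (intro Bochner_Integration.integral_sum) auto
    also have "\<dots> \<le> 0" using one by (intro sum_nonpos) auto
    finally show ?thesis .
  qed
  let ?g = "\<lambda>x. indicator K x * (if z x > 0 then q x else 0)"
  have lim: "(\<lambda>k. indicator K x * (smooth_step k (z x) * q x)) \<longlonglongrightarrow> ?g x" for x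
  proof -
    have "(\<lambda>k. indicator K x * (smooth_step k (z x) * q x)) \<longlonglongrightarrow>
        indicator K x * ((if z x > 0 then 1 else 0) * q x)"
      by (intro tendsto_intros smooth_step_tendsto)
    then show ?thesis by (simp split: if_splits)
  qed
  have meas: "(\<lambda>x. indicator K x * (smooth_step k (z x) * q x)) \<in> borel_measurable lborel" for k
    using gint[OF cq] by (rule borel_measurable_integrable)
  have measg: "?g \<in> borel_measurable lborel"
    by (rule borel_measurable_LIMSEQ_metric[OF meas lim])
  have w: "integrable lborel (\<lambda>x. indicator K x * \<bar>q x\<bar>)"
    using borel_integrable_compact[OF K(1), of "\<lambda>x. \<bar>q x\<bar>"] cq by (simp add: continuous_on_rabs)
  have bnd: "norm (indicator K x * (smooth_step k (z x) * q x)) \<le> indicator K x * \<bar>q x\<bar>" for k x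
    using smooth_step_bounds[of k "z x"] by (auto simp: indicator_def abs_mult mult_left_le_one_le)
  show "integrable lborel ?g"
    by (rule integrable_dominated_convergence[OF measg meas w AE_I2[OF lim] AE_I2[OF bnd]])
  have "(\<lambda>k. \<integral>x. indicator K x * (smooth_step k (z x) * q x) \<partial>lborel) \<longlonglongrightarrow> integral\<^sup>L lborel ?g"
    by (rule integral_dominated_convergence[OF measg meas w AE_I2[OF lim] AE_I2[OF bnd]])
  then show "integral\<^sup>L lborel ?g \<le> 0"
    by (rule LIMSEQ_le_const2) (use step in auto)
qed

text \<open>The subgradient inequality for the positive part at the \<^emph>\<open>later\<close> value: it avoids
  differentiating the positive part in time.\<close>

lemma positive_part_diff_le: "max 0 a - max 0 b \<le> (if a > 0 then a - b else (0::real))"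
  by auto

text \<open>On a short interval the subgradient inequality at the right end bounds the increment of
  the integral by the length of the interval times the integral of \<open>dt\<close> over the set
  where \<open>d\<close> is positive, up to an error controlled by the uniform continuity of
  \<open>dt\<close>. The main term is at most zero, and over a fine partition the errors add up to
  an arbitrarily small total.\<close>

lemma integral_positive_part_antimono:
  fixes d :: "'a::euclidean_space \<Rightarrow> real \<Rightarrow> real"
  assumes K: "compact K" and T: "0 < t1" "t1 \<le> t2"
    and dt: "\<And>x t. x \<in> K \<Longrightarrow> t1 \<le> t \<Longrightarrow> t \<le> t2 \<Longrightarrow> ((\<lambda>s. d x s) has_real_derivative dt x t) (at t)"
    and cdt: "continuous_on (K \<times> {t1..t2}) (\<lambda>(x, t). dt x t)"
    and cd: "\<And>t. t1 \<le> t \<Longrightarrow> t \<le> t2 \<Longrightarrow> continuous_on K (\<lambda>x. d x t)"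
    and int: "\<And>t. t1 \<le> t \<Longrightarrow> t \<le> t2 \<Longrightarrow>
      integrable lborel (\<lambda>x. indicator K x * (if d x t > 0 then dt x t else 0))"
    and le0: "\<And>t. t1 \<le> t \<Longrightarrow> t \<le> t2 \<Longrightarrow>
      (\<integral>x. indicator K x * (if d x t > 0 then dt x t else 0) \<partial>lborel) \<le> 0"
  shows "(\<integral>x. indicator K x * max 0 (d x t2) \<partial>lborel) \<le> (\<integral>x. indicator K x * max 0 (d x t1) \<partial>lborel)"
proof -
  define I where "I = (\<lambda>t. \<integral>x. indicator K x * max 0 (d x t) \<partial>lborel)"
  have iI: "integrable lborel (\<lambda>x. indicator K x * max 0 (d x t))" if "t1 \<le> t" "t \<le> t2" for t
    using borel_integrable_compact[OF K, of "\<lambda>x. max 0 (d x t)"] cd[OF that]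
    by (simp add: continuous_on_max)
  have iK: "integrable lborel (\<lambda>x. indicator K x * c)" for c :: real
    using borel_integrable_compact[OF K continuous_on_const[of K c]] by simp
  define C where "C = (\<integral>x. indicator K x * (1::real) \<partial>lborel)"
  have C: "C \<ge> 0" unfolding C_def by (rule integral_nonneg_AE) auto
  have uc: "uniformly_continuous_on (K \<times> {t1..t2}) (\<lambda>(x, t). dt x t)"
    by (intro compact_uniformly_continuous cdt compact_Times K compact_Icc)
  have small: "\<exists>h>0. \<forall>s t. t1 \<le> s \<and> s \<le> t \<and> t \<le> t2 \<and> t - s < h \<longrightarrow> I t - I s \<le> e * C * (t - s)"
    if "e > 0" for e
  proof -
    obtain h where h: "h > 0" "\<And>p p'. p \<in> K \<times> {t1..t2} \<Longrightarrow> p' \<in> K \<times> {t1..t2} \<Longrightarrow> dist p' p < h \<Longrightarrow>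
        dist (case p' of (x, t) \<Rightarrow> dt x t) (case p of (x, t) \<Rightarrow> dt x t) < e"
      using uc \<open>e > 0\<close> unfolding uniformly_continuous_on_def by meson
    have "I t - I s \<le> e * C * (t - s)" if st: "t1 \<le> s" "s \<le> t" "t \<le> t2" "t - s < h" for s t
    proof -
      have pt: "max 0 (d x t) - max 0 (d x s) \<le> (t - s) * ((if d x t > 0 then dt x t else 0) + e)"
        if x: "x \<in> K" for x
      proof -
        have "d x t - d x s \<le> (t - s) * (dt x t + e)"
        proof (cases "s < t")
          case True
          have "\<exists>l. s < l \<and> l < t \<and> d x t - d x s = (t - s) * dt x l"
            by (rule MVT2[OF True]) (use dt x st in auto)
          then obtain l where l: "s < l" "l < t" "d x t - d x s = (t - s) * dt x l" by blast
          have "dist (case (x, l) of (x, t) \<Rightarrow> dt x t) (case (x, t) of (x, t) \<Rightarrow> dt x t) < e"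
            by (rule h(2)) (use x l st in \<open>auto simp: dist_Pair_Pair dist_real_def\<close>)
          then have "dt x l \<le> dt x t + e" by (simp add: dist_real_def)
          then show ?thesis using l st by (simp add: mult_left_mono)
        next
          case False
          then show ?thesis using st by simp
        qed
        \<comment> \<open>If \<open>d x t\<close> is not positive, the positive part has not
          increased, and the bound only asks the error term to be nonnegative.\<close>
        moreover have "0 \<le> (t - s) * e" using st \<open>e > 0\<close> by simp
        ultimately show ?thesis using positive_part_diff_le[of "d x t" "d x s"]
          by (auto split: if_splits)
      qed
      have "I t - I s = (\<integral>x. indicator K x * max 0 (d x t) - indicator K x * max 0 (d x s) \<partial>lborel)"
        unfolding I_def using st iI by (intro Bochner_Integration.integral_diff[symmetric]) auto
      also have "\<dots> \<le> (\<integral>x. (t - s) * (indicator K x * (if d x t > 0 then dt x t else 0) + e * (indicator K x * 1)) \<partial>lborel)"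
      proof (rule integral_mono)
        show "indicat_real K x * max 0 (d x t) - indicat_real K x * max 0 (d x s)
          \<le> (t - s) * (indicat_real K x * (if d x t > 0 then dt x t else 0) + e * (indicator K x * 1))" for x
          using pt[of x] by (auto simp: indicator_def)
      qed (use st iI int iK in auto)
      also have "\<dots> = (t - s) * ((\<integral>x. indicator K x * (if d x t > 0 then dt x t else 0) \<partial>lborel) + e * C)"
        unfolding C_def using st int iK by simp
      also have "\<dots> \<le> (t - s) * (0 + e * C)"
        using le0[of t] st by (intro mult_left_mono add_right_mono) auto
      finally show ?thesis by (simp add: mult_ac)
    qed
    then show ?thesis using h(1) by blast
  qed
  have "I t2 - I t1 \<le> e * C * (t2 - t1)" if "e > 0" for e
  proof -
    obtain h where h: "h > 0" "\<And>s t. t1 \<le> s \<Longrightarrow> s \<le> t \<Longrightarrow> t \<le> t2 \<Longrightarrow> t - s < h \<Longrightarrow> I t - I s \<le> e * C * (t - s)"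
      using small[OF \<open>e > 0\<close>] by blast
    obtain N :: nat where N: "(t2 - t1) / h < real N" using reals_Archimedean2 by blast
    have N0: "N > 0" using N T h(1) by (cases N) (auto simp: divide_less_0_iff)
    define l where "l = (t2 - t1) / real N"
    have l: "l \<ge> 0" "l < h" "real N * l = t2 - t1"
      using N N0 T h(1) by (auto simp: l_def field_simps)
    \<comment> \<open>Telescoping over \<open>N\<close> intervals of length
      \<open>l < h\<close>.\<close>
    have "j \<le> N \<longrightarrow> I (t1 + real j * l) - I t1 \<le> e * C * (real j * l)" for j
    proof (induction j)
      case (Suc j)
      show ?case
      proof
        assume j: "Suc j \<le> N"
        have "real (Suc j) * l \<le> real N * l" using j l(1) by (intro mult_right_mono) auto
        then have "I (t1 + real (Suc j) * l) - I (t1 + real j * l) \<le>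
            e * C * ((t1 + real (Suc j) * l) - (t1 + real j * l))"
          using l by (intro h(2)) (auto simp: algebra_simps)
        then show "I (t1 + real (Suc j) * l) - I t1 \<le> e * C * (real (Suc j) * l)"
          using Suc j by (simp add: algebra_simps)
      qed
    qed simp
    from this[of N] show ?thesis using l(3) by simp
  qed
  note bd = this
  have "I t2 - I t1 \<le> 0"
  proof (rule field_le_epsilon)
    fix e :: real assume "e > 0"
    \<comment> \<open>The summand 1 keeps the divisor positive even if \<open>C\<close> or the
      length of the interval is zero.\<close>
    define c where "c = C * (t2 - t1) + 1"
    have c: "c > 0" "C * (t2 - t1) \<le> c" using C T by (auto simp: c_def add_nonneg_pos)
    have "I t2 - I t1 \<le> e / c * (C * (t2 - t1))"
      using bd[of "e / c"] c \<open>e > 0\<close> by (simp add: mult_ac)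
    also have "\<dots> \<le> e / c * c" using c \<open>e > 0\<close> by (intro mult_left_mono) auto
    finally show "I t2 - I t1 \<le> 0 + e" using c by simp
  qed
  then show ?thesis by (simp add: I_def)
qed

text \<open>Here \<open>d\<close> stands for subsolution minus solution and \<open>z\<close> for the
  difference of their m-th powers. Kato's inequality is applied to \<open>z\<close> while the time
  derivative is that of \<open>d\<close>; the two are linked only by being positive at the same
  points, so the nonlinearity enters through monotonicity alone. The integral of the positive part
  of \<open>d\<close> then cannot increase, and it starts from zero.\<close>

lemma nonpos_of_parabolic_inequality:
  fixes d :: "'a::euclidean_space \<Rightarrow> real \<Rightarrow> real"
  assumes \<Omega>: "open \<Omega>" and K: "compact K" "K \<subseteq> \<Omega>"
    and dt: "\<And>x t. x \<in> \<Omega> \<Longrightarrow> 0 < t \<Longrightarrow> t \<le> T \<Longrightarrow> ((\<lambda>s. d x s) has_real_derivative dt x t) (at t)"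
    and cdt: "continuous_on (\<Omega> \<times> {0<..T}) (\<lambda>(x, t). dt x t)"
    and cd: "\<And>t. 0 < t \<Longrightarrow> t \<le> T \<Longrightarrow> continuous_on \<Omega> (\<lambda>x. d x t)"
    and cz: "\<And>t. 0 < t \<Longrightarrow> t \<le> T \<Longrightarrow> continuous_on \<Omega> (\<lambda>x. z x t)"
    and cD: "\<And>t b. 0 < t \<Longrightarrow> t \<le> T \<Longrightarrow> b \<in> Basis \<Longrightarrow> continuous_on \<Omega> (\<lambda>x. D b x t)"
    and cD2: "\<And>t b. 0 < t \<Longrightarrow> t \<le> T \<Longrightarrow> b \<in> Basis \<Longrightarrow> continuous_on \<Omega> (\<lambda>x. DD b x t)"
    and d1: "\<And>x t b. x \<in> \<Omega> \<Longrightarrow> 0 < t \<Longrightarrow> t \<le> T \<Longrightarrow> b \<in> Basis \<Longrightarrow>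
      ((\<lambda>s. z (x + s *\<^sub>R b) t) has_real_derivative D b x t) (at 0)"
    and d2: "\<And>x t b. x \<in> \<Omega> \<Longrightarrow> 0 < t \<Longrightarrow> t \<le> T \<Longrightarrow> b \<in> Basis \<Longrightarrow>
      ((\<lambda>s. D b (x + s *\<^sub>R b) t) has_real_derivative DD b x t) (at 0)"
    and sgn: "\<And>x t. x \<in> \<Omega> \<Longrightarrow> 0 < t \<Longrightarrow> t \<le> T \<Longrightarrow> z x t > 0 \<longleftrightarrow> d x t > 0"
    and off: "\<And>x t. x \<in> \<Omega> - K \<Longrightarrow> 0 < t \<Longrightarrow> t \<le> T \<Longrightarrow> d x t \<le> 0"
    and ineq: "\<And>x t. x \<in> \<Omega> \<Longrightarrow> 0 < t \<Longrightarrow> t \<le> T \<Longrightarrow> dt x t \<le> (\<Sum>b\<in>Basis. DD b x t)"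
    and init: "((\<lambda>t. \<integral>\<^sup>+x. ennreal (d x t) \<partial>lebesgue_on K) \<longlongrightarrow> 0) (at_right 0)"
    and x: "x \<in> \<Omega>" and t: "0 < t" "t \<le> T"
  shows "d x t \<le> 0"
proof -
  define I where "I = (\<lambda>t. \<integral>x. indicator K x * max 0 (d x t) \<partial>lborel)"
  have cdtx: "continuous_on K (\<lambda>x. dt x t)" if "0 < t" "t \<le> T" for t
  proof -
    have "continuous_on K (\<lambda>x. case (x, t) of (x, t) \<Rightarrow> dt x t)"
      by (rule continuous_on_compose2[OF cdt]) (use K that in \<open>auto intro!: continuous_intros\<close>)
    then show ?thesis by simp
  qed
  have cdK: "continuous_on K (\<lambda>x. d x t)" if "0 < t" "t \<le> T" for t
    using cd[OF that] K continuous_on_subset by blast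
  have mono: "I t2 \<le> I t1" if t12: "0 < t1" "t1 \<le> t2" "t2 \<le> T" for t1 t2
    unfolding I_def
  proof (rule integral_positive_part_antimono[OF K(1) t12(1,2), where dt = dt])
    show "continuous_on (K \<times> {t1..t2}) (\<lambda>(x, t). dt x t)"
      by (rule continuous_on_subset[OF cdt]) (use K t12 in auto)
    fix t assume t: "t1 \<le> t" "t \<le> t2"
    then have tt: "0 < t" "t \<le> T" using t12 by auto
    have eq: "indicator K x * (if d x t > 0 then dt x t else 0) =
        indicator K x * (if z x t > 0 then dt x t else (0::real))" for x
      using sgn[of x t] tt K by (auto simp: indicator_def)
    have off': "z x t \<le> 0" if "x \<in> \<Omega> - K" for x
      using off[OF that tt] sgn[of x t] tt that by force
    note kato = kato_integral_nonpos[OF \<Omega> K cz[OF tt] cD[OF tt] cD2[OF tt] d1[OF _ tt] d2[OF _ tt]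
        off' cdtx[OF tt] ineq[OF _ tt]]
    show "integrable lborel (\<lambda>x. indicator K x * (if d x t > 0 then dt x t else 0))"
      unfolding eq by (rule kato(1)) (use K in auto)
    show "(\<integral>x. indicator K x * (if d x t > 0 then dt x t else 0) \<partial>lborel) \<le> 0"
      unfolding eq by (rule kato(2)) (use K in auto)
    show "continuous_on K (\<lambda>x. d x t)" by (rule cdK[OF tt])
    show "((\<lambda>s. d x s) has_real_derivative dt x t) (at t)" if "x \<in> K" for x
      using dt tt that K by blast
  qed
  have iI: "integrable lborel (\<lambda>x. indicator K x * max 0 (d x t))" if "0 < t" "t \<le> T" for t
    using borel_integrable_compact[OF K(1), of "\<lambda>x. max 0 (d x t)"] cdK[OF that]
    by (simp add: continuous_on_max)
  \<comment> \<open>\<open>ennreal\<close> sends negative numbers to 0, so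
    \<open>ennreal (d x t)\<close> already encodes the positive part.\<close>
  have nn: "ennreal (I t) = (\<integral>\<^sup>+x. ennreal (d x t) \<partial>lebesgue_on K)" if "0 < t" "t \<le> T" for t
  proof -
    have "ennreal (I t) = (\<integral>\<^sup>+x. ennreal (indicator K x * max 0 (d x t)) \<partial>lborel)"
      unfolding I_def by (rule nn_integral_eq_integral[symmetric]) (use iI[OF that] in auto)
    also have "\<dots> = (\<integral>\<^sup>+x. ennreal (indicator K x * max 0 (d x t)) \<partial>lebesgue)"
      using borel_measurable_integrable[OF iI[OF that]] by (intro nn_integral_completion[symmetric])
    also have "\<dots> = (\<integral>\<^sup>+x. ennreal (d x t) * indicator K x \<partial>lebesgue)"
      by (intro nn_integral_cong) (auto simp: indicator_def max_def ennreal_neg)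
    also have "\<dots> = (\<integral>\<^sup>+x. ennreal (d x t) \<partial>lebesgue_on K)"
      using K by (intro nn_integral_restrict_space[symmetric]) (auto simp: compact_imp_closed)
    finally show ?thesis .
  qed
  have "ennreal (I t) \<le> 0"
  proof (rule tendsto_lowerbound[OF init])
    have "\<forall>\<^sub>F s in at_right (0::real). s \<in> {0<..<t}" by (rule eventually_at_right_real[OF t(1)])
    then show "\<forall>\<^sub>F s in at_right 0. ennreal (I t) \<le> (\<integral>\<^sup>+x. ennreal (d x s) \<partial>lebesgue_on K)"
      by eventually_elim (use mono[of _ t] t nn in \<open>auto simp flip: nn intro!: ennreal_leI\<close>)
  qed simp
  then have "I t \<le> 0" by (simp add: ennreal_eq_0_iff)
  moreover have "I t \<ge> 0" unfolding I_def by (rule integral_nonneg_AE) auto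
  ultimately have "I t = 0" by simp
  then have ae: "AE x in lborel. indicator K x * max 0 (d x t) = 0"
    unfolding I_def by (subst (asm) integral_nonneg_eq_0_iff_AE[OF iI[OF t]]) auto
  \<comment> \<open>Passage from almost everywhere to everywhere: the set where \<open>d\<close> is
    positive is open and null, hence empty.\<close>
  define S where "S = {x \<in> \<Omega>. d x t > 0}"
  have S: "open S" unfolding S_def
    using continuous_on_open_vimage[OF \<Omega>, of "\<lambda>x. d x t"] cd[OF t]
    by (auto simp: vimage_def Int_def conj_commute elim!: allE[of _ "{0<..}"])
  have "S \<subseteq> K" using off t by (force simp: S_def)
  have "AE x in lborel. x \<notin> S"
    using ae by eventually_elim (use \<open>S \<subseteq> K\<close> in \<open>auto simp: S_def\<close>)
  then have "S \<in> null_sets lborel" using S using AE_iff_null_sets[of S lborel] by simp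
  then have "negligible S" by (simp add: negligible_iff_null_sets null_sets_completionI)
  then have "S = {}" using open_not_negligible[OF S] by blast
  then show ?thesis using x by (force simp: S_def)
qed

subsection \<open>Explicit subsolutions\<close>

text \<open>\<open>q\<close> stands for the power \<open>\<psi> powr m\<close> on \<open>\<Omega>\<close>; its value outside \<open>\<Omega>\<close> is irrelevant.\<close>

lemma classical_solution_comparison:
  fixes v \<psi> :: "'a::euclidean_space \<Rightarrow> real \<Rightarrow> real"
  assumes m: "0 < m" and v: "positive_classical_solution m UNIV v"
    and \<Omega>: "open \<Omega>" and K: "compact K" "K \<subseteq> \<Omega>"
    and pos: "\<And>x t. x \<in> \<Omega> \<Longrightarrow> 0 < t \<Longrightarrow> t \<le> T \<Longrightarrow> 0 < \<psi> x t"
    and c\<psi>: "\<And>t. 0 < t \<Longrightarrow> t \<le> T \<Longrightarrow> continuous_on \<Omega> (\<lambda>x. \<psi> x t)"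
    and d\<psi>: "\<And>x t. x \<in> \<Omega> \<Longrightarrow> 0 < t \<Longrightarrow> t \<le> T \<Longrightarrow> ((\<lambda>s. \<psi> x s) has_real_derivative \<psi>t x t) (at t)"
    and c\<psi>t: "continuous_on (\<Omega> \<times> {0<..T}) (\<lambda>(x, t). \<psi>t x t)"
    and q: "\<And>x t. x \<in> \<Omega> \<Longrightarrow> 0 < t \<Longrightarrow> t \<le> T \<Longrightarrow> q x t = \<psi> x t powr m"
    and q1: "\<And>x t b. x \<in> \<Omega> \<Longrightarrow> 0 < t \<Longrightarrow> t \<le> T \<Longrightarrow> b \<in> Basis \<Longrightarrow>
      ((\<lambda>s. q (x + s *\<^sub>R b) t) has_real_derivative Q b x t) (at 0)"
    and q2: "\<And>x t b. x \<in> \<Omega> \<Longrightarrow> 0 < t \<Longrightarrow> t \<le> T \<Longrightarrow> b \<in> Basis \<Longrightarrow>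
      ((\<lambda>s. Q b (x + s *\<^sub>R b) t) has_real_derivative QQ b x t) (at 0)"
    and cQ: "\<And>t b. 0 < t \<Longrightarrow> t \<le> T \<Longrightarrow> b \<in> Basis \<Longrightarrow> continuous_on \<Omega> (\<lambda>x. Q b x t)"
    and cQ2: "\<And>t b. 0 < t \<Longrightarrow> t \<le> T \<Longrightarrow> b \<in> Basis \<Longrightarrow> continuous_on \<Omega> (\<lambda>x. QQ b x t)"
    and sub: "\<And>x t. x \<in> \<Omega> \<Longrightarrow> 0 < t \<Longrightarrow> t \<le> T \<Longrightarrow> \<psi>t x t \<le> (\<Sum>b\<in>Basis. QQ b x t)"
    and off: "\<And>x t. x \<in> \<Omega> - K \<Longrightarrow> 0 < t \<Longrightarrow> t \<le> T \<Longrightarrow> \<psi> x t \<le> v x t"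
    and init: "((\<lambda>t. \<integral>\<^sup>+x. ennreal (\<psi> x t - v x t) \<partial>lebesgue_on K) \<longlongrightarrow> 0) (at_right 0)"
    and x: "x \<in> \<Omega>" and t: "0 < t" "t \<le> T"
  shows "\<psi> x t \<le> v x t"
proof -
  have vpos: "0 < v x t" if "t > 0" for x t
    using v that by (auto simp: positive_classical_solution_def)
  have "C21_on UNIV v" using v by (simp add: positive_classical_solution_def)
  then obtain vt Dv D2v where
    derivs: "\<forall>x\<in>UNIV. \<forall>t>0.
        ((\<lambda>s. v x s) has_real_derivative vt x t) (at t) \<and>
        (\<forall>b\<in>Basis. ((\<lambda>s. v (x + s *\<^sub>R b) t) has_real_derivative Dv b x t) (at 0)) \<and>
        (\<forall>b\<in>Basis. \<forall>c\<in>Basis.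
           ((\<lambda>s. Dv b (x + s *\<^sub>R c) t) has_real_derivative D2v b c x t) (at 0))"
    and cv: "continuous_on (UNIV \<times> {0<..}) (\<lambda>(x, t). v x t)"
    and cvt: "continuous_on (UNIV \<times> {0<..}) (\<lambda>(x, t). vt x t)"
    and cDv: "\<forall>b\<in>Basis. continuous_on (UNIV \<times> {0<..}) (\<lambda>(x, t). Dv b x t)"
    and cD2v: "\<forall>b\<in>Basis. \<forall>c\<in>Basis. continuous_on (UNIV \<times> {0<..}) (\<lambda>(x, t). D2v b c x t)"
    unfolding C21_on_def by (elim exE conjE) blast
  have vt: "((\<lambda>s. v x s) has_real_derivative vt x t) (at t)" if "0 < t" for x t
    using derivs that by blast
  have Dv: "((\<lambda>s. v (x + s *\<^sub>R b) t) has_real_derivative Dv b x t) (at 0)"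
    if "0 < t" "b \<in> Basis" for x t b
    using derivs that by blast
  have D2v: "((\<lambda>s. Dv b (x + s *\<^sub>R c) t) has_real_derivative D2v b c x t) (at 0)"
    if "0 < t" "b \<in> Basis" "c \<in> Basis" for x t b c
    using derivs that by blast
  note cDv = bspec[OF cDv] and cD2v = bspec[OF bspec[OF cD2v]]
  have slice: "continuous_on S (\<lambda>x. f x t)" if "continuous_on (UNIV \<times> {0<..}) (\<lambda>(x, t). f x t)" "t > 0"
    for f :: "'a \<Rightarrow> real \<Rightarrow> real" and t S
  proof -
    have "continuous_on S (\<lambda>x. case (x, t) of (x, t) \<Rightarrow> f x t)"
      by (rule continuous_on_compose2[OF that(1)]) (use that in \<open>auto intro!: continuous_intros\<close>)
    then show ?thesis by simp
  qed
  \<comment> \<open>By the chain rule \<open>P\<close> and \<open>P2\<close> are the first and the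
    pure second space derivatives of \<open>v powr m\<close>.\<close>
  define P where "P = (\<lambda>b x t. m * v x t powr (m - 1) * Dv b x t)"
  define P2 where "P2 = (\<lambda>b x t. m * ((m - 1) * v x t powr (m - 1 - 1) * Dv b x t) * Dv b x t
      + m * v x t powr (m - 1) * D2v b b x t)"
  have P: "((\<lambda>s. v (x + s *\<^sub>R b) t powr m) has_real_derivative P b x t) (at 0)"
    if "0 < t" "b \<in> Basis" for x t b
    using DERIV_chain2[OF has_real_derivative_powr Dv[OF that, of x], of m] vpos[OF that(1), of x]
    by (simp add: P_def)
  have P2: "((\<lambda>s. P b (x + s *\<^sub>R b) t) has_real_derivative P2 b x t) (at 0)"
    if "0 < t" "b \<in> Basis" for x t b
  proof -
    have "((\<lambda>s. v (x + s *\<^sub>R b) t powr (m - 1)) has_real_derivative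
        (m - 1) * v x t powr (m - 1 - 1) * Dv b x t) (at 0)"
      using DERIV_chain2[OF has_real_derivative_powr Dv[OF that, of x], of "m - 1"] vpos[OF that(1), of x]
      by simp
    from DERIV_cmult[OF DERIV_mult[OF this D2v[OF that that(2), of x]], of m]
    show ?thesis by (simp add: P_def P2_def algebra_simps)
  qed
  have eq: "vt x t = (\<Sum>b\<in>Basis. P2 b x t)" if "0 < t" for x t
  proof -
    \<comment> \<open>The first partial derivative is identified as a function on the whole space,
      because \<open>laplacian\<close> differentiates it once more.\<close>
    have 1: "partial_deriv b (\<lambda>y. v y t powr m) = (\<lambda>x. P b x t)" if "b \<in> Basis" for b
      unfolding partial_deriv_def using DERIV_imp_deriv[OF P[OF \<open>0 < t\<close> that]] by auto
    have 2: "partial_deriv b (\<lambda>x. P b x t) x = P2 b x t" if "b \<in> Basis" for b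
      unfolding partial_deriv_def using DERIV_imp_deriv[OF P2[OF \<open>0 < t\<close> that]] by auto
    have "vt x t = laplacian (\<lambda>y. v y t powr m) x"
      using v that DERIV_imp_deriv[OF vt[OF that, of x]] by (auto simp: positive_classical_solution_def)
    also have "\<dots> = (\<Sum>b\<in>Basis. P2 b x t)"
      unfolding laplacian_def by (intro sum.cong) (auto simp: 1 2)
    finally show ?thesis .
  qed
  have cpow: "continuous_on S (\<lambda>x. v x t powr r)" if "t > 0" for t S r
    by (rule continuous_on_powr[OF slice[OF cv that]]) (auto intro!: continuous_intros simp: vpos[OF that] less_imp_neq[symmetric])
  have "\<psi> x t - v x t \<le> 0"
  proof (rule nonpos_of_parabolic_inequality[OF \<Omega> K, where d = "\<lambda>x t. \<psi> x t - v x t"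
        and dt = "\<lambda>x t. \<psi>t x t - vt x t" and z = "\<lambda>x t. q x t - v x t powr m"
        and D = "\<lambda>b x t. Q b x t - P b x t" and DD = "\<lambda>b x t. QQ b x t - P2 b x t" and T = T])
    have "continuous_on (\<Omega> \<times> {0<..T}) (\<lambda>p. (case p of (x, t) \<Rightarrow> \<psi>t x t) - (case p of (x, t) \<Rightarrow> vt x t))"
      by (intro continuous_on_diff c\<psi>t continuous_on_subset[OF cvt]) auto
    then show "continuous_on (\<Omega> \<times> {0<..T}) (\<lambda>(x, t). \<psi>t x t - vt x t)"
      by (simp add: case_prod_unfold)
    fix t assume t: "0 < t" "t \<le> T"
    show "continuous_on \<Omega> (\<lambda>x. \<psi> x t - v x t)"
      by (intro continuous_on_diff c\<psi> t slice[OF cv])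
    have "continuous_on \<Omega> (\<lambda>x. \<psi> x t powr m)"
      by (rule continuous_on_powr[OF c\<psi>[OF t]]) (use pos[OF _ t] in \<open>auto intro!: continuous_intros simp: less_imp_neq[symmetric]\<close>)
    then have "continuous_on \<Omega> (\<lambda>x. q x t)"
      by (rule continuous_on_eq) (use q t in auto)
    then show "continuous_on \<Omega> (\<lambda>x. q x t - v x t powr m)"
      by (intro continuous_on_diff cpow t)
    fix b :: 'a assume b: "b \<in> Basis"
    show "continuous_on \<Omega> (\<lambda>x. Q b x t - P b x t)" unfolding P_def
      by (intro continuous_intros cQ t b cpow slice[OF cDv])
    show "continuous_on \<Omega> (\<lambda>x. QQ b x t - P2 b x t)" unfolding P2_def
      by (intro continuous_intros cQ2 t b cpow slice[OF cDv] slice[OF cD2v])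
  next
    fix x t assume x: "x \<in> \<Omega>" and t: "0 < t" "t \<le> T"
    have "\<psi> x t > 0" "v x t > 0" using pos[OF x t] vpos[OF t(1)] by auto
    then show "(0 < q x t - v x t powr m) = (0 < \<psi> x t - v x t)"
      using powr_less_mono2[OF m, of "v x t" "\<psi> x t"]
        powr_mono2[of m "\<psi> x t" "v x t"] m q[OF x t] by force
    show "\<psi>t x t - vt x t \<le> (\<Sum>b\<in>Basis. QQ b x t - P2 b x t)"
      using sub[OF x t] eq[OF t(1), of x] by (simp add: sum_subtractf)
  qed (use d\<psi> vt q1 q2 P P2 off init x t in \<open>auto intro!: derivative_intros\<close>)
  then show ?thesis by simp
qed

section \<open>A decaying subsolution in a ball\<close>

lemma has_derivative_along_line:
  fixes x c b :: "'a::real_inner"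
  shows "((\<lambda>s. (x + s *\<^sub>R b - c) \<bullet> (x + s *\<^sub>R b - c)) has_real_derivative 2 * ((x - c) \<bullet> b)) (at 0)"
    and "((\<lambda>s. (x + s *\<^sub>R b - c) \<bullet> b) has_real_derivative b \<bullet> b) (at 0)"
proof -
  have "(\<lambda>s. (x + s *\<^sub>R b - c) \<bullet> (x + s *\<^sub>R b - c)) =
      (\<lambda>s. (x - c) \<bullet> (x - c) + 2 * s * ((x - c) \<bullet> b) + s\<^sup>2 * (b \<bullet> b))"
    by (auto simp: fun_eq_iff inner_simps power2_eq_square algebra_simps inner_commute)
  then show "((\<lambda>s. (x + s *\<^sub>R b - c) \<bullet> (x + s *\<^sub>R b - c)) has_real_derivative 2 * ((x - c) \<bullet> b)) (at 0)"
    by (auto intro!: derivative_eq_intros)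
  have "(\<lambda>s. (x + s *\<^sub>R b - c) \<bullet> b) = (\<lambda>s. (x - c) \<bullet> b + s * (b \<bullet> b))"
    by (auto simp: fun_eq_iff inner_simps algebra_simps)
  then show "((\<lambda>s. (x + s *\<^sub>R b - c) \<bullet> b) has_real_derivative b \<bullet> b) (at 0)"
    by (auto intro!: derivative_eq_intros)
qed

lemma sum_inner_Basis_square: "(\<Sum>b\<in>Basis. (x \<bullet> b)\<^sup>2) = x \<bullet> (x::'a::euclidean_space)"
  using euclidean_inner[of x x] by (simp add: power2_eq_square)

text \<open>The subsolution is \<open>\<theta> t * G x powr (2 / m)\<close>, where \<open>G\<close>
  vanishes on the sphere and \<open>\<theta>\<close> falls linearly from \<open>H\<close> to
  \<open>H / 2\<close>. The exponent makes its m-th power a multiple of the polynomial G^2. Near the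
  sphere the Laplacian of G^2 is nonnegative; in the rest of the ball \<open>G\<close> is bounded
  below, and for \<open>T\<close> as short as \<open>small\<close> demands the decay in time
  outweighs the negative Laplacian.\<close>

lemma interior_lower_bound:
  fixes v :: "'a::euclidean_space \<Rightarrow> real \<Rightarrow> real" and c :: 'a
  assumes m: "0 < m" and v: "positive_classical_solution m UNIV v"
    and attains: "attains_initial_L1loc UNIV v v0"
    and eps: "0 < \<epsilon>" "\<And>x t. 0 < t \<Longrightarrow> \<epsilon> \<le> v x t"
    and r: "0 < r" and H: "0 < H" and T: "0 < T"
    and v0: "AE x in lebesgue. x \<in> ball c r \<longrightarrow> H \<le> v0 x"
    and small: "8 * real DIM('a) * T * H powr m \<le> H * (2 / (2 + real DIM('a))) powr (2 / m) * r\<^sup>2"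
    and x: "x \<in> ball c r" and t: "0 < t" "t \<le> T"
  shows "H / 2 * (1 - (norm (x - c))\<^sup>2 / r\<^sup>2) powr (2 / m) \<le> v x t"
proof -
  define n where "n = real DIM('a)"
  have n: "n > 0" by (simp add: n_def)
  define G where "G = (\<lambda>x::'a. 1 - ((x - c) \<bullet> (x - c)) / r\<^sup>2)"
  define \<theta> where "\<theta> = (\<lambda>t. H * (1 - t / (2 * T)))"
  have \<theta>: "H / 2 \<le> \<theta> t" "\<theta> t \<le> H" "0 < \<theta> t" if "0 < t" "t \<le> T" for t
  proof -
    have "t / (2 * T) \<le> 1 / 2" "0 \<le> t / (2 * T)" using that T by (auto simp: field_simps)
    then have "1 / 2 \<le> 1 - t / (2 * T)" "1 - t / (2 * T) \<le> 1" by auto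
    then show 1: "H / 2 \<le> \<theta> t" "\<theta> t \<le> H"
      using H mult_left_mono[of "1/2" "1 - t / (2 * T)" H] mult_left_mono[of "1 - t / (2 * T)" 1 H]
      by (auto simp: \<theta>_def)
    then show "0 < \<theta> t" using H by linarith
  qed
  have Gball: "x \<in> ball c r \<longleftrightarrow> 0 < G x" for x
  proof -
    have "x \<in> ball c r \<longleftrightarrow> (norm (x - c))\<^sup>2 < r\<^sup>2"
      using r power_strict_mono[of "norm (x - c)" r 2] power_less_imp_less_base[of "norm (x - c)" 2 r]
      by (auto simp: dist_norm norm_minus_commute)
    then show ?thesis using r by (simp add: G_def power2_norm_eq_inner)
  qed
  have G1: "G x \<le> 1" for x using r by (simp add: G_def)
  have cG: "continuous_on S G" for S unfolding G_def using r by (intro continuous_intros) auto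
  define \<psi> where "\<psi> = (\<lambda>x t. \<theta> t * G x powr (2 / m))"
  define \<psi>t where "\<psi>t = (\<lambda>x (t::real). - (H / (2 * T)) * G x powr (2 / m))"
  define q where "q = (\<lambda>x t. \<theta> t powr m * (G x)\<^sup>2)"
  define Q where "Q = (\<lambda>b x t. \<theta> t powr m * (2 * G x * (- (2 * ((x - c) \<bullet> b)) / r\<^sup>2)))"
  define QQ where "QQ = (\<lambda>b x t. \<theta> t powr m * (8 * ((x - c) \<bullet> b)\<^sup>2 / r ^ 4 - 4 * G x / r\<^sup>2))"
  \<comment> \<open>\<open>g\<close> solves H g^(2/m) = \<epsilon>. Where \<open>G x < g\<close> the
    subsolution therefore lies below \<open>\<epsilon>\<close>, hence below \<open>v\<close>, and
    the comparison reduces to the compact set \<open>K\<close> inside the open ball.\<close>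
  define g where "g = (\<epsilon> / H) powr (m / 2)"
  have g: "g > 0" using eps H by (simp add: g_def)
  define K where "K = {x. g \<le> G x}"
  have K\<Omega>: "K \<subseteq> ball c r" using g by (force simp: K_def Gball simp del: mem_ball)
  have "bounded K" using K\<Omega> bounded_ball bounded_subset by blast
  moreover have "closed K" unfolding K_def by (intro closed_Collect_le continuous_on_const cG)
  ultimately have K: "compact K" by (simp add: compact_eq_bounded_closed)
  have cGp: "continuous_on (ball c r) (\<lambda>x. G x powr (2 / m))"
    by (rule continuous_on_powr[OF cG]) (auto intro!: continuous_intros simp: Gball simp del: mem_ball)
  have dG: "((\<lambda>s. G (x + s *\<^sub>R b)) has_real_derivative - (2 * ((x - c) \<bullet> b)) / r\<^sup>2) (at 0)" for x b
    unfolding G_def using r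
    by (auto intro!: derivative_eq_intros has_derivative_along_line simp: field_simps)
  have "\<psi> x t \<le> v x t"
  proof (rule classical_solution_comparison[OF m v open_ball K K\<Omega>, where T = T and \<psi> = \<psi> and \<psi>t = \<psi>t and q = q
        and Q = Q and QQ = QQ])
    fix x t assume x: "x \<in> ball c r" and t: "0 < t" "t \<le> T"
    have Gx: "0 < G x" using x Gball by simp
    show "0 < \<psi> x t" using Gx \<theta>[OF t] by (simp add: \<psi>_def)
    show "((\<lambda>s. \<psi> x s) has_real_derivative \<psi>t x t) (at t)"
      unfolding \<psi>_def \<psi>t_def \<theta>_def using T by (auto intro!: derivative_eq_intros)
    show "q x t = \<psi> x t powr m"
      using Gx \<theta>[OF t] m by (simp add: q_def \<psi>_def powr_mult powr_powr)
    show "((\<lambda>s. q (x + s *\<^sub>R b) t) has_real_derivative Q b x t) (at 0)" for b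
      unfolding q_def Q_def using DERIV_cmult[OF DERIV_power[OF dG[of x b], of 2], of "\<theta> t powr m"]
      by (simp add: mult_ac)
    show "((\<lambda>s. Q b (x + s *\<^sub>R b) t) has_real_derivative QQ b x t) (at 0)" if "b \<in> Basis" for b
    proof -
      have "((\<lambda>s. - (2 * ((x + s *\<^sub>R b - c) \<bullet> b)) / r\<^sup>2) has_real_derivative - 2 / r\<^sup>2) (at 0)"
        using DERIV_cdivide[OF DERIV_cmult[OF has_derivative_along_line(2)[of x b c], of "-2"], of "r\<^sup>2"]
          inner_same_Basis[OF that] by simp
      from DERIV_cmult[OF DERIV_mult[OF dG[of x b] this], of "2 * \<theta> t powr m"]
      have "((\<lambda>s. Q b (x + s *\<^sub>R b) t) has_real_derivative 2 * \<theta> t powr m *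
          (4 * ((x - c) \<bullet> b)\<^sup>2 / (r\<^sup>2 * r\<^sup>2) + - 2 / r\<^sup>2 * G x)) (at 0)"
        by (simp add: Q_def mult_ac power2_eq_square[of "(x - c) \<bullet> b"])
      moreover have "2 * \<theta> t powr m * (4 * ((x - c) \<bullet> b)\<^sup>2 / (r\<^sup>2 * r\<^sup>2) + - 2 / r\<^sup>2 * G x) = QQ b x t"
        using r by (simp add: QQ_def power_add[symmetric] algebra_simps)
      ultimately show ?thesis by metis
    qed
    have sumQ2: "(\<Sum>b\<in>Basis. QQ b x t) = \<theta> t powr m * (8 - (8 + 4 * n) * G x) / r\<^sup>2"
    proof -
      have "(\<Sum>b\<in>Basis. QQ b x t) =
          \<theta> t powr m * (8 * (\<Sum>b\<in>Basis. ((x - c) \<bullet> b)\<^sup>2) / r ^ 4 - n * (4 * G x / r\<^sup>2))"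
        unfolding QQ_def
        by (simp add: sum_distrib_left[symmetric] sum_subtractf sum_divide_distrib[symmetric] n_def)
      also have "(\<Sum>b\<in>Basis. ((x - c) \<bullet> b)\<^sup>2) = r\<^sup>2 * (1 - G x)"
        unfolding sum_inner_Basis_square G_def using r by simp
      also have "8 * (r\<^sup>2 * (1 - G x)) / r ^ 4 = 8 * (1 - G x) / r\<^sup>2"
        using r by (simp add: power2_eq_square power4_eq_xxxx)
      finally show ?thesis by (simp add: algebra_simps diff_divide_distrib add_divide_distrib)
    qed
    show "\<psi>t x t \<le> (\<Sum>b\<in>Basis. QQ b x t)"
    \<comment> \<open>The threshold is the zero of \<open>8 - (8 + 4 * n) * G x\<close>, where the
      Laplacian of G^2 changes sign.\<close>
    proof (cases "G x \<le> 2 / (2 + n)")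
      case True
      then have "0 \<le> 8 - (8 + 4 * n) * G x" using n by (simp add: field_simps)
      then have "0 \<le> (\<Sum>b\<in>Basis. QQ b x t)" unfolding sumQ2 by simp
      moreover have "\<psi>t x t \<le> 0" using H T by (simp add: \<psi>t_def)
      ultimately show ?thesis by simp
    next
      case False
      define g1 where "g1 = (2 / (2 + n)) powr (2 / m)"
      have "g1 \<le> G x powr (2 / m)" unfolding g1_def using False n m by (intro powr_mono2) auto
      then have "\<psi>t x t \<le> - (H / (2 * T)) * g1"
        using H T by (simp add: \<psi>t_def divide_right_mono mult_left_mono)
      \<comment> \<open>This is \<open>small\<close> rearranged; the factor 8 there is the 2 from
        the slope of \<open>\<theta>\<close> times the 4 from the Laplacian bound.\<close>
      also have "\<dots> \<le> - (H powr m * (4 * n) / r\<^sup>2)"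
        using small r T unfolding g1_def[symmetric] n_def[symmetric] by (simp add: field_simps)
      also have "\<dots> \<le> - (\<theta> t powr m * (4 * n) / r\<^sup>2)"
        using \<theta>[OF t] m n r by (simp add: divide_right_mono mult_right_mono powr_mono2)
      also have "\<dots> = \<theta> t powr m * (- 4 * n) / r\<^sup>2" by simp
      also have "\<dots> \<le> (\<Sum>b\<in>Basis. QQ b x t)"
      proof -
        have "(8 + 4 * n) * G x \<le> (8 + 4 * n) * 1" using G1[of x] n by (intro mult_left_mono) auto
        then have "- 4 * n \<le> 8 - (8 + 4 * n) * G x" by simp
        then show ?thesis unfolding sumQ2 by (intro divide_right_mono mult_left_mono) auto
      qed
      finally show ?thesis .
    qed
  next
    fix t assume t: "0 < t" "t \<le> T"
    show "continuous_on (ball c r) (\<lambda>x. \<psi> x t)" unfolding \<psi>_def by (intro continuous_intros cGp)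
    show "continuous_on (ball c r) (\<lambda>x. Q b x t)" for b
      unfolding Q_def using r by (intro continuous_intros cG) auto
    show "continuous_on (ball c r) (\<lambda>x. QQ b x t)" for b
      unfolding QQ_def using r by (intro continuous_intros cG) auto
    fix x assume x: "x \<in> ball c r - K"
    then have "0 < G x" "G x < g" by (auto simp: K_def Gball simp del: mem_ball)
    then have "G x powr (2 / m) \<le> g powr (2 / m)" using m by (intro powr_mono2) auto
    also have "\<dots> = \<epsilon> / H" using m eps H by (simp add: g_def powr_powr)
    finally have "H * G x powr (2 / m) \<le> \<epsilon>" using H by (simp add: field_simps)
    moreover have "\<psi> x t \<le> H * G x powr (2 / m)"
      unfolding \<psi>_def using \<theta>[OF t] by (intro mult_right_mono) auto
    ultimately show "\<psi> x t \<le> v x t" using eps(2)[OF t(1), of x] by linarith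
  next
    have "continuous_on (ball c r \<times> {0<..T}) (\<lambda>p. - (H / (2 * T)) * G (fst p) powr (2 / m))"
      by (intro continuous_on_mult continuous_on_const continuous_on_compose2[OF cGp])
        (auto intro!: continuous_intros)
    then show "continuous_on (ball c r \<times> {0<..T}) (\<lambda>(x, t). \<psi>t x t)"
      by (simp add: \<psi>t_def case_prod_unfold)
    have lim: "((\<lambda>t. \<integral>\<^sup>+x. ennreal \<bar>v x t - v0 x\<bar> \<partial>lebesgue_on K) \<longlongrightarrow> 0) (at_right 0)"
      using attains K by (auto simp: attains_initial_L1loc_def)
    show "((\<lambda>t. \<integral>\<^sup>+x. ennreal (\<psi> x t - v x t) \<partial>lebesgue_on K) \<longlongrightarrow> 0) (at_right 0)"
    \<comment> \<open>On \<open>K\<close> the subsolution is at most \<open>H\<close>, hence at most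
      \<open>v0\<close> almost everywhere, so the positive part of \<open>\<psi> - v\<close> is
      bounded by the distance of \<open>v\<close> from its initial value.\<close>
    proof (rule tendsto_sandwich[OF _ _ tendsto_const lim])
      have "\<forall>\<^sub>F s in at_right (0::real). s \<in> {0<..<T}" by (rule eventually_at_right_real[OF T])
      then show "\<forall>\<^sub>F s in at_right 0. (\<integral>\<^sup>+x. ennreal (\<psi> x s - v x s) \<partial>lebesgue_on K) \<le>
          (\<integral>\<^sup>+x. ennreal \<bar>v x s - v0 x\<bar> \<partial>lebesgue_on K)"
      proof eventually_elim
        case (elim s)
        then have s: "0 < s" "s \<le> T" by auto
        have "AE x in lebesgue_on K. x \<in> ball c r \<longrightarrow> H \<le> v0 x"
          using v0 K by (subst AE_restrict_space_iff) (auto simp: compact_imp_closed elim: eventually_mono)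
        moreover have "AE x in lebesgue_on K. x \<in> K"
          using K by (subst AE_restrict_space_iff) (auto simp: compact_imp_closed)
        ultimately have "AE x in lebesgue_on K. ennreal (\<psi> x s - v x s) \<le> ennreal \<bar>v x s - v0 x\<bar>"
        proof eventually_elim
          case (elim x)
          then have xb: "x \<in> ball c r" using K\<Omega> by blast
          have "G x powr (2 / m) \<le> 1 powr (2 / m)" using Gball[of x] xb G1[of x] m by (intro powr_mono2) auto
          then have "\<psi> x s \<le> H * 1" unfolding \<psi>_def using \<theta>[OF s] by (intro mult_mono) auto
          then show ?case using elim xb by (intro ennreal_leI) auto
        qed
        then show ?case by (rule nn_integral_mono_AE)
      qed
    qed simp
  qed (use x t in auto)
  moreover have "H / 2 * G x powr (2 / m) \<le> \<psi> x t"
    unfolding \<psi>_def using \<theta>[OF t] by (intro mult_right_mono) auto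
  ultimately show ?thesis by (simp add: G_def power2_norm_eq_inner)
qed

text \<open>The exponent \<open>\<beta> = k / m - 2\<close> is chosen so that the Laplacian of $|x|^{-\beta}$ decays exactly like
  the \<open>1 / m\<close>-th power of the harmonic tail $|x|^{-k}$, which it has to dominate.\<close>

lemma exterior_lower_bound:
  fixes v :: "'a::euclidean_space \<Rightarrow> real \<Rightarrow> real" and c :: 'a and m :: real
  defines "k \<equiv> real DIM('a) - 2"
  defines "\<beta> \<equiv> k / m - 2"
  defines "E \<equiv> (1 + 4 powr (\<beta> - k)) powr (1 / m)"
  assumes m: "0 < m" "m < 1" and k: "0 < k" and \<beta>: "k < \<beta>"
    and v: "positive_classical_solution m UNIV v"
    and eps: "0 < \<epsilon>" "\<And>x t. 0 < t \<Longrightarrow> \<epsilon> \<le> v x t"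
    and r: "0 < r" and H: "0 < H" and T: "0 < T" and A: "0 < A"
    and inner: "\<And>x t. norm (x - c) < r / 2 \<Longrightarrow> 0 < t \<Longrightarrow> t \<le> T \<Longrightarrow> H * B \<le> v x t"
    and AB: "A * E * 4 powr (\<beta> + 2) \<le> B"
    and small: "H * A * E * r\<^sup>2 \<le> (1 - m) * T * (\<beta> * (\<beta> - k)) * (H powr m * A powr m)"
    and x: "r \<le> norm (x - c)"
  shows "H * A * (norm (x - c) / r) powr (- k / m) \<le> v x T"
proof -
  have E: "0 < E" unfolding E_def powr_gt_zero by (smt (verit) powr_ge_zero)
  \<comment> \<open>\<open>P s\<close> is the power -s of the scaled distance to \<open>c\<close>,
    and \<open>P1\<close>, \<open>P2\<close> are its first and second derivatives in direction
    \<open>b\<close>. It is written through the squared distance \<open>N\<close>, which is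
    polynomial along lines.\<close>
  define N where "N = (\<lambda>x::'a. ((x - c) \<bullet> (x - c)) / r\<^sup>2)"
  define P where "P = (\<lambda>s x. N x powr (- s / 2))"
  define P1 where "P1 = (\<lambda>s b x. - s / r\<^sup>2 * (P (s + 2) x * ((x - c) \<bullet> b)))"
  define P2 where "P2 = (\<lambda>s b x. - s / r\<^sup>2 * (P1 (s + 2) b x * ((x - c) \<bullet> b) + P (s + 2) x))"
  have Nn: "N x = (norm (x - c) / r)\<^sup>2" for x
    by (simp add: N_def power_divide power2_norm_eq_inner)
  define \<Omega> where "\<Omega> = {x. 1 / 16 < N x}"
  have cN: "continuous_on S N" for S unfolding N_def using r by (intro continuous_intros) auto
  have \<Omega>: "open \<Omega>" unfolding \<Omega>_def by (intro open_Collect_less continuous_on_const cN)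
  have Npos: "0 < N x" if "x \<in> \<Omega>" for x using that by (simp add: \<Omega>_def)
  have Ppos: "0 < P s x" if "x \<in> \<Omega>" for s x using Npos[OF that] by (simp add: P_def)
  have cP: "continuous_on \<Omega> (P s)" for s
    unfolding P_def by (rule continuous_on_powr[OF cN]) (auto intro!: continuous_intros dest: Npos)
  have cP1: "continuous_on \<Omega> (P1 s b)" for s b
    unfolding P1_def using r by (intro continuous_intros cP)
  have cP2: "continuous_on \<Omega> (P2 s b)" for s b
    unfolding P2_def using r by (intro continuous_intros cP cP1)
  have dP: "((\<lambda>h. P s (x + h *\<^sub>R b)) has_real_derivative P1 s b x) (at 0)" if x: "x \<in> \<Omega>" for s x b
  proof -
    have "((\<lambda>h. N (x + h *\<^sub>R b)) has_real_derivative 2 * ((x - c) \<bullet> b) / r\<^sup>2) (at 0)"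
      unfolding N_def by (rule DERIV_cdivide[OF has_derivative_along_line(1)])
    from DERIV_chain2[OF has_real_derivative_powr this, of "- s / 2"]
    have "((\<lambda>h. P s (x + h *\<^sub>R b)) has_real_derivative
        - s / 2 * N x powr (- s / 2 - 1) * (2 * ((x - c) \<bullet> b) / r\<^sup>2)) (at 0)"
      using Npos[OF x] by (simp add: P_def)
    moreover have "N x powr (- s / 2 - 1) = P (s + 2) x"
      unfolding P_def by (rule arg_cong[where f = "\<lambda>e. N x powr e"]) (simp add: field_simps)
    ultimately show ?thesis
      by (elim DERIV_cong) (simp add: P1_def)
  qed
  have dP1: "((\<lambda>h. P1 s b (x + h *\<^sub>R b)) has_real_derivative P2 s b x) (at 0)"
    if x: "x \<in> \<Omega>" and b: "b \<in> Basis" for s x b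
  proof -
    have "((\<lambda>h. (x + h *\<^sub>R b - c) \<bullet> b) has_real_derivative 1) (at 0)"
      using has_derivative_along_line(2)[of x b c] inner_same_Basis[OF b] by simp
    from DERIV_cmult[OF DERIV_mult[OF dP[OF x, of "s + 2" b] this], of "- s / r\<^sup>2"]
    show ?thesis by (simp add: P1_def P2_def)
  qed
  \<comment> \<open>The Laplacian of a radial power: it vanishes for \<open>s = k\<close>, the
    harmonic tail, and is positive for \<open>s = \<beta>\<close> because
    \<open>k < \<beta>\<close>.\<close>
  have sumP2: "(\<Sum>b\<in>Basis. P2 s b x) = s * (s - k) / r\<^sup>2 * P (s + 2) x" if x: "x \<in> \<Omega>" for s x
  proof -
    have *: "P (s + 2 + 2) x * N x = P (s + 2) x"
    proof -
      have "P (s + 2 + 2) x * N x = N x powr (- (s + 2 + 2) / 2) * N x powr 1"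
        unfolding P_def powr_one[OF less_imp_le[OF Npos[OF x]]] ..
      also have "\<dots> = N x powr (- (s + 2 + 2) / 2 + 1)" by (rule powr_add[symmetric])
      also have "- (s + 2 + 2) / 2 + 1 = - (s + 2) / 2" by (simp add: field_simps)
      finally show ?thesis unfolding P_def .
    qed
    have P1x: "P1 e b x * ((x - c) \<bullet> b) = - e / r\<^sup>2 * P (e + 2) x * ((x - c) \<bullet> b)\<^sup>2" for e b
      by (simp add: P1_def power2_eq_square)
    have "(\<Sum>b\<in>Basis. P1 (s + 2) b x * ((x - c) \<bullet> b)) =
        (\<Sum>b\<in>Basis. - (s + 2) / r\<^sup>2 * P (s + 2 + 2) x * ((x - c) \<bullet> b)\<^sup>2)"
      unfolding P1x ..
    also have "\<dots> = - (s + 2) / r\<^sup>2 * P (s + 2 + 2) x * (r\<^sup>2 * N x)"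
      unfolding sum_distrib_left[symmetric] sum_inner_Basis_square using r by (simp add: N_def)
    also have "\<dots> = - (s + 2) * (P (s + 2 + 2) x * N x)" using r by simp
    finally have "(\<Sum>b\<in>Basis. P1 (s + 2) b x * ((x - c) \<bullet> b)) = - (s + 2) * P (s + 2) x"
      unfolding * .
    moreover have "(\<Sum>b\<in>Basis. P2 s b x) =
        - s / r\<^sup>2 * ((\<Sum>b\<in>Basis. P1 (s + 2) b x * ((x - c) \<bullet> b)) + real DIM('a) * P (s + 2) x)"
      unfolding P2_def sum_distrib_left[symmetric] sum.distrib by simp
    ultimately have "(\<Sum>b\<in>Basis. P2 s b x) =
        - s / r\<^sup>2 * (- (s + 2) * P (s + 2) x + real DIM('a) * P (s + 2) x)" by (simp only:)
    also have "\<dots> = s * (s - k) / r\<^sup>2 * P (s + 2) x" using r by (simp add: k_def field_simps)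
    finally show ?thesis .
  qed
  \<comment> \<open>\<open>P k\<close> provides the tail but no positive Laplacian;
    \<open>P \<beta>\<close> adds one and decays faster, so it leaves the size of the tail unchanged
    up to the factor \<open>E\<close>.\<close>
  define \<phi> where "\<phi> = (\<lambda>x. P k x + P \<beta> x)"
  have \<phi>pos: "0 < \<phi> x" if "x \<in> \<Omega>" for x using Ppos[OF that] by (simp add: \<phi>_def add_pos_pos)
  have c\<phi>: "continuous_on \<Omega> \<phi>" unfolding \<phi>_def by (intro continuous_intros cP)
  have c\<phi>m: "continuous_on \<Omega> (\<lambda>x. \<phi> x powr (1 / m))"
    by (rule continuous_on_powr[OF c\<phi>]) (use \<phi>pos in \<open>auto intro!: continuous_intros simp: less_imp_neq[symmetric]\<close>)
  have Pk: "P k x powr (1 / m) = P (\<beta> + 2) x" if "x \<in> \<Omega>" for x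
    unfolding P_def powr_powr by (rule arg_cong[where f = "\<lambda>e. N x powr e"]) (use m in \<open>simp add: \<beta>_def field_simps\<close>)
  have \<phi>le: "\<phi> x powr (1 / m) \<le> E * P (\<beta> + 2) x" if x: "x \<in> \<Omega>" for x
  proof -
    \<comment> \<open>On \<open>\<Omega>\<close> the scaled distance exceeds 1/4, which bounds the
      quotient of \<open>P \<beta>\<close> by \<open>P k\<close> and gives the constant in
      \<open>E\<close>.\<close>
    have "N x powr (- (\<beta> - k) / 2) \<le> (1 / 16) powr (- (\<beta> - k) / 2)"
      using x \<beta> by (intro powr_mono2') (auto simp: \<Omega>_def)
    also have "(1 / 16 :: real) = 4 powr (- 2)" by (simp add: powr_minus powr_numeral)
    also have "(4 powr (- 2)) powr (- (\<beta> - k) / 2) = (4::real) powr (\<beta> - k)"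
      unfolding powr_powr by (rule arg_cong[where f = "\<lambda>e. 4 powr e"]) (simp add: field_simps)
    finally have "P k x * N x powr (- (\<beta> - k) / 2) \<le> P k x * 4 powr (\<beta> - k)"
      using Ppos[OF x, of k] by (intro mult_left_mono) auto
    moreover have "P \<beta> x = P k x * N x powr (- (\<beta> - k) / 2)"
      unfolding P_def powr_add[symmetric] by (rule arg_cong[where f = "\<lambda>e. N x powr e"]) (simp add: field_simps)
    ultimately have "\<phi> x \<le> P k x * (1 + 4 powr (\<beta> - k))" by (simp add: \<phi>_def algebra_simps)
    then have "\<phi> x powr (1 / m) \<le> (P k x * (1 + 4 powr (\<beta> - k))) powr (1 / m)"
      using m \<phi>pos[OF x] by (intro powr_mono2) auto
    also have "\<dots> = P k x powr (1 / m) * E"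
      unfolding E_def using Ppos[OF x, of k] by (intro powr_mult)
    finally show ?thesis using Pk[OF x] by (simp add: mult.commute)
  qed
  have tau: "0 < t / T" "t / T \<le> 1" if "0 < t" "t \<le> T" for t using that T by auto
  \<comment> \<open>The power 1/(1-m) of time is the one for which the time derivative and the m-th
    power carry the same factor t^(m/(1-m)), so the differential inequality becomes one between
    constants.\<close>
  define \<psi> where "\<psi> = (\<lambda>x t. H * A * (t / T) powr (1 / (1 - m)) * \<phi> x powr (1 / m))"
  define \<psi>t where "\<psi>t = (\<lambda>x t. H * A / ((1 - m) * T) * (t / T) powr (m / (1 - m)) * \<phi> x powr (1 / m))"
  define w where "w = (\<lambda>t. H powr m * A powr m * (t / T) powr (m / (1 - m)))"
  define q where "q = (\<lambda>x t. w t * \<phi> x)"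
  define Q where "Q = (\<lambda>b x t. w t * (P1 k b x + P1 \<beta> b x))"
  define QQ where "QQ = (\<lambda>b x t. w t * (P2 k b x + P2 \<beta> b x))"
  have \<psi>le: "\<psi> x t \<le> H * A * E * P (\<beta> + 2) x" if x: "x \<in> \<Omega>" and t: "0 < t" "t \<le> T" for x t
  proof -
    have "(t / T) powr (1 / (1 - m)) \<le> 1 powr (1 / (1 - m))"
      using tau[OF t] m by (intro powr_mono2) auto
    then have "\<psi> x t \<le> H * A * 1 * (E * P (\<beta> + 2) x)"
      unfolding \<psi>_def using H A \<phi>le[OF x] by (intro mult_mono) auto
    then show ?thesis by simp
  qed
  \<comment> \<open>Beyond \<open>N x = L\<close> the bound \<open>\<psi>le\<close> is at most
    \<open>\<epsilon>\<close>. The set \<open>K\<close> below is the annulus from distance r/2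
    outwards to this radius; between r/4 and r/2 the hypothesis \<open>inner\<close> gives the
    comparison.\<close>
  define L where "L = (H * A * E / \<epsilon>) powr (2 / (\<beta> + 2))"
  have L: "0 < L" using H A E eps by (simp add: L_def)
  define K where "K = {x. 1 / 4 \<le> N x \<and> N x \<le> L}"
  have K\<Omega>: "K \<subseteq> \<Omega>" by (auto simp: K_def \<Omega>_def)
  have "closed K" unfolding K_def
    by (intro closed_Collect_conj closed_Collect_le continuous_on_const cN)
  moreover have "bounded K"
  proof (rule bounded_subset[OF bounded_cball[of c "sqrt L * r"]], rule subsetI)
    fix x assume "x \<in> K"
    then have "(norm (x - c) / r)\<^sup>2 \<le> L" by (simp add: K_def Nn)
    then have "norm (x - c) / r \<le> sqrt L" by (rule real_le_rsqrt)
    then show "x \<in> cball c (sqrt L * r)" using r by (simp add: dist_norm norm_minus_commute field_simps)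
  qed
  ultimately have K: "compact K" by (simp add: compact_eq_bounded_closed)
  have PL: "H * A * E * P (\<beta> + 2) x \<le> \<epsilon>" if "L < N x" for x
  proof -
    have "P (\<beta> + 2) x \<le> L powr (- (\<beta> + 2) / 2)"
      unfolding P_def using that L k \<beta> by (intro powr_mono2') auto
    also have "\<dots> = (H * A * E / \<epsilon>) powr (- 1)"
      unfolding L_def powr_powr by (rule arg_cong[where f = "\<lambda>e. (H * A * E / \<epsilon>) powr e"])
        (use k \<beta> in \<open>simp add: field_simps\<close>)
    also have "\<dots> = \<epsilon> / (H * A * E)" using H A E eps by (simp add: powr_minus less_imp_le)
    finally show ?thesis using H A E by (simp add: field_simps)
  qed
  have P16: "P (\<beta> + 2) x \<le> 4 powr (\<beta> + 2)" if "x \<in> \<Omega>" for x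
  proof -
    have "P (\<beta> + 2) x \<le> (1 / 16) powr (- (\<beta> + 2) / 2)"
      unfolding P_def using that k \<beta> by (intro powr_mono2') (auto simp: \<Omega>_def)
    also have "(1 / 16 :: real) = 4 powr (- 2)" by (simp add: powr_minus powr_numeral)
    also have "(4 powr (- 2)) powr (- (\<beta> + 2) / 2) = (4::real) powr (\<beta> + 2)"
      unfolding powr_powr by (rule arg_cong[where f = "\<lambda>e. 4 powr e"]) (simp add: field_simps)
    finally show ?thesis .
  qed
  have "\<psi> x T \<le> v x T"
  proof (rule classical_solution_comparison[OF m(1) v \<Omega> K K\<Omega>, where T = T and \<psi> = \<psi> and \<psi>t = \<psi>t
        and q = q and Q = Q and QQ = QQ])
    fix x t assume x: "x \<in> \<Omega>" and t: "0 < t" "t \<le> T"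
    show "0 < \<psi> x t" unfolding \<psi>_def
      using t T H A \<phi>pos[OF x] by (intro mult_pos_pos) (auto simp: powr_gt_zero)
    have "((\<lambda>s. s / T) has_real_derivative 1 / T) (at t)" using T by (auto intro!: derivative_eq_intros)
    from DERIV_chain2[OF has_real_derivative_powr this, of "1 / (1 - m)"]
    have "((\<lambda>s. (s / T) powr (1 / (1 - m))) has_real_derivative
        1 / (1 - m) * (t / T) powr (1 / (1 - m) - 1) * (1 / T)) (at t)"
      using tau[OF t] by simp
    moreover have "1 / (1 - m) - 1 = m / (1 - m)" using m by (simp add: field_simps)
    ultimately have "((\<lambda>s. (s / T) powr (1 / (1 - m))) has_real_derivative
        1 / (1 - m) * (t / T) powr (m / (1 - m)) * (1 / T)) (at t)" by simp
    from DERIV_cmult[OF this, of "H * A * \<phi> x powr (1 / m)"]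
    show "((\<lambda>s. \<psi> x s) has_real_derivative \<psi>t x t) (at t)"
      by (simp add: \<psi>_def \<psi>t_def mult_ac)
    show "q x t = \<psi> x t powr m"
      unfolding q_def \<psi>_def w_def using tau[OF t] H A \<phi>pos[OF x] m by (simp add: powr_mult powr_powr)
    show "((\<lambda>s. q (x + s *\<^sub>R b) t) has_real_derivative Q b x t) (at 0)" for b
      unfolding q_def Q_def \<phi>_def by (intro DERIV_cmult DERIV_add dP x)
    show "((\<lambda>s. Q b (x + s *\<^sub>R b) t) has_real_derivative QQ b x t) (at 0)" if "b \<in> Basis" for b
      unfolding Q_def QQ_def by (intro DERIV_cmult DERIV_add dP1 x that)
    have "(\<Sum>b\<in>Basis. QQ b x t) = w t * (\<beta> * (\<beta> - k) / r\<^sup>2 * P (\<beta> + 2) x)"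
      unfolding QQ_def sum_distrib_left[symmetric] sum.distrib sumP2[OF x] by simp
    moreover have "\<psi>t x t \<le> w t * (\<beta> * (\<beta> - k) / r\<^sup>2 * P (\<beta> + 2) x)"
    proof -
      \<comment> \<open>This is \<open>small\<close> divided by positive factors; \<open>E\<close>
        comes from estimating \<open>\<phi> x powr (1 / m)\<close> by
        \<open>P (\<beta> + 2) x\<close>.\<close>
      have "H * A * E / ((1 - m) * T) \<le> H powr m * A powr m * (\<beta> * (\<beta> - k)) / r\<^sup>2"
        using small m T r by (simp add: field_simps)
      then have "(H * A * E / ((1 - m) * T)) * ((t / T) powr (m / (1 - m)) * P (\<beta> + 2) x)
          \<le> (H powr m * A powr m * (\<beta> * (\<beta> - k)) / r\<^sup>2) * ((t / T) powr (m / (1 - m)) * P (\<beta> + 2) x)"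
        using Ppos[OF x, of "\<beta> + 2"] by (intro mult_right_mono) auto
      also have "\<dots> = w t * (\<beta> * (\<beta> - k) / r\<^sup>2 * P (\<beta> + 2) x)"
        by (simp add: w_def mult_ac)
      finally have "(H * A * E / ((1 - m) * T)) * ((t / T) powr (m / (1 - m)) * P (\<beta> + 2) x)
          \<le> w t * (\<beta> * (\<beta> - k) / r\<^sup>2 * P (\<beta> + 2) x)" .
      moreover have "\<psi>t x t \<le> H * A / ((1 - m) * T) * (t / T) powr (m / (1 - m)) * (E * P (\<beta> + 2) x)"
        unfolding \<psi>t_def using H A m T by (intro mult_left_mono \<phi>le[OF x]) auto
      ultimately show ?thesis by (simp add: mult_ac)
    qed
    ultimately show "\<psi>t x t \<le> (\<Sum>b\<in>Basis. QQ b x t)" by simp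
  next
    fix t assume t: "0 < t" "t \<le> T"
    show "continuous_on \<Omega> (\<lambda>x. \<psi> x t)" unfolding \<psi>_def by (intro continuous_intros c\<phi>m)
    show "continuous_on \<Omega> (\<lambda>x. Q b x t)" for b unfolding Q_def by (intro continuous_intros cP1)
    show "continuous_on \<Omega> (\<lambda>x. QQ b x t)" for b unfolding QQ_def by (intro continuous_intros cP2)
    fix x assume x: "x \<in> \<Omega> - K"
    then consider "N x < 1 / 4" | "L < N x" by (auto simp: K_def)
    then show "\<psi> x t \<le> v x t"
    proof cases
      case 1
      then have "(norm (x - c) / r)\<^sup>2 < (1 / 2)\<^sup>2" by (simp add: Nn power2_eq_square)
      then have "norm (x - c) / r < 1 / 2" by (rule power_less_imp_less_base) simp
      then have "norm (x - c) < r / 2" using r by (simp add: field_simps)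
      note inner[OF this t]
      moreover have "\<psi> x t \<le> H * A * E * 4 powr (\<beta> + 2)"
        using \<psi>le[of x t] P16[of x] x t H A E
        by (intro order_trans[OF \<psi>le]) (auto intro!: mult_left_mono)
      moreover have "H * (A * E * 4 powr (\<beta> + 2)) \<le> H * B" using AB H by (intro mult_left_mono) auto
      ultimately show ?thesis by (simp add: mult_ac)
    next
      case 2
      then show ?thesis using PL[OF 2] \<psi>le[of x t] x t eps(2)[OF t(1), of x] by auto
    qed
  next
    have "continuous_on (\<Omega> \<times> {0<..T}) (\<lambda>p. H * A / ((1 - m) * T) * (snd p / T) powr (m / (1 - m)) * \<phi> (fst p) powr (1 / m))"
      using T m by (intro continuous_on_mult continuous_on_const continuous_on_compose2[OF c\<phi>m] continuous_on_powr')
        (auto intro!: continuous_intros)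
    then show "continuous_on (\<Omega> \<times> {0<..T}) (\<lambda>(x, t). \<psi>t x t)"
      by (simp add: \<psi>t_def case_prod_unfold)
    define M where "M = H * A * E * 4 powr (\<beta> + 2)"
    have "((\<lambda>t. M * (t / T) powr (1 / (1 - m))) \<longlongrightarrow> M * (0 / T) powr (1 / (1 - m))) (at_right 0)"
    proof -
      have "((\<lambda>t. t / T) \<longlongrightarrow> 0 / T) (at_right 0)" using T by (intro tendsto_intros) auto
      moreover have "\<forall>\<^sub>F t in at_right 0. 0 \<le> t / T"
        using eventually_at_right_less[of "0::real"] by eventually_elim (use T in auto)
      ultimately show ?thesis using m by (intro tendsto_mult tendsto_const tendsto_powr') auto
    qed
    then have "((\<lambda>t. M * (t / T) powr (1 / (1 - m))) \<longlongrightarrow> 0) (at_right 0)" by simp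
    then have "\<forall>\<^sub>F t in at_right 0. M * (t / T) powr (1 / (1 - m)) < \<epsilon>"
      using eps(1) by (rule order_tendstoD(2))
    moreover have "\<forall>\<^sub>F t in at_right (0::real). t \<in> {0<..<T}" by (rule eventually_at_right_real[OF T])
    \<comment> \<open>Since \<psi> tends to zero uniformly on \<open>K\<close> as t tends to 0 while
      \<open>v\<close> stays above \<open>\<epsilon>\<close>, the integral is exactly zero for all
      small times.\<close>
    ultimately have ev: "\<forall>\<^sub>F t in at_right 0. (\<integral>\<^sup>+x. ennreal (\<psi> x t - v x t) \<partial>lebesgue_on K) = 0"
    proof eventually_elim
      case (elim t)
      have "ennreal (\<psi> x t - v x t) = 0" if "x \<in> K" for x
      proof -
        have x: "x \<in> \<Omega>" using that K\<Omega> by blast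
        have "\<phi> x powr (1 / m) \<le> E * 4 powr (\<beta> + 2)"
          using \<phi>le[OF x] P16[OF x] E by (meson mult_left_mono order_trans less_imp_le)
        then have "\<psi> x t \<le> H * A * (t / T) powr (1 / (1 - m)) * (E * 4 powr (\<beta> + 2))"
          unfolding \<psi>_def using H A by (intro mult_left_mono) auto
        also have "\<dots> = M * (t / T) powr (1 / (1 - m))" by (simp add: M_def mult_ac)
        finally have "\<psi> x t \<le> v x t" using elim eps(2)[of t x] by auto
        then show ?thesis by (simp add: ennreal_eq_0_iff)
      qed
      then have "(\<integral>\<^sup>+x. ennreal (\<psi> x t - v x t) \<partial>lebesgue_on K) = (\<integral>\<^sup>+x. 0 \<partial>lebesgue_on K)"
        by (intro nn_integral_cong) (auto simp: space_restrict_space)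
      then show ?case by simp
    qed
    show "((\<lambda>t. \<integral>\<^sup>+x. ennreal (\<psi> x t - v x t) \<partial>lebesgue_on K) \<longlongrightarrow> 0) (at_right 0)"
      using ev by (rule tendsto_eventually)
  next
    have "1 \<le> N x" using x r by (simp add: Nn)
    then show "x \<in> \<Omega>" by (simp add: \<Omega>_def)
  qed (use T in auto)
  moreover have "H * A * (norm (x - c) / r) powr (- k / m) \<le> \<psi> x T"
  proof -
    have "1 \<le> N x" using x r by (simp add: Nn)
    then have x': "x \<in> \<Omega>" by (simp add: \<Omega>_def)
    have "(norm (x - c) / r) powr (- k / m) = P (\<beta> + 2) x"
    proof -
      have "0 < norm (x - c) / r" using x r by (intro divide_pos_pos) linarith+
      then have N2: "N x = (norm (x - c) / r) powr 2" by (simp add: Nn)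
      show ?thesis unfolding P_def N2 powr_powr
        by (rule arg_cong[where f = "\<lambda>e. (norm (x - c) / r) powr e"]) (use m in \<open>simp add: \<beta>_def field_simps\<close>)
    qed
    also have "\<dots> = P k x powr (1 / m)" using Pk[OF x'] by simp
    also have "\<dots> \<le> \<phi> x powr (1 / m)"
      using m Ppos[OF x', of k] Ppos[OF x', of \<beta>] by (intro powr_mono2) (auto simp: \<phi>_def)
    finally show ?thesis unfolding \<psi>_def using H A T by (simp add: mult_left_mono)
  qed
  ultimately show ?thesis by linarith
qed

section \<open>From a lower bound on a ball to a lower bound on its exterior\<close>

text \<open>The interior estimate on the half ball supplies the hypothesis \<open>inner\<close> of
  the exterior one. With time measured in units of H^(1-m) r^2, all remaining conditions are free of
  \<open>H\<close> and \<open>r\<close>, so \<open>c0\<close> and \<open>A\<close> depend only on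
  the dimension and \<open>m\<close>.\<close>

lemma source_spreads:
  assumes n: "3 \<le> DIM('a::euclidean_space)" and m: "0 < m" "m < (real DIM('a) - 2) / real DIM('a)"
  shows "\<exists>c0>0. \<exists>A>0. \<forall>(v::'a \<Rightarrow> real \<Rightarrow> real) v0 \<epsilon> r H c.
    positive_classical_solution m UNIV v \<longrightarrow> attains_initial_L1loc UNIV v v0 \<longrightarrow>
    0 < \<epsilon> \<longrightarrow> (\<forall>x. \<forall>t>0. \<epsilon> \<le> v x t) \<longrightarrow> 0 < r \<longrightarrow> 0 < H \<longrightarrow>
    (AE x in lebesgue. x \<in> ball c r \<longrightarrow> H \<le> v0 x) \<longrightarrow>
    (\<forall>x. r \<le> norm (x - c) \<longrightarrow>
      H * A * (norm (x - c) / r) powr (- (real DIM('a) - 2) / m) \<le> v x (c0 * H powr (1 - m) * r\<^sup>2))"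
proof -
  define k where "k = real DIM('a) - 2"
  define \<beta> where "\<beta> = k / m - 2"
  define E where "E = (1 + 4 powr (\<beta> - k)) powr (1 / m)"
  define g where "g = (2 / (2 + real DIM('a))) powr (2 / m)"
  \<comment> \<open>\<open>c0\<close> gives equality in the smallness condition of the interior
    estimate, and \<open>B\<close> is the value of its lower bound at distance r/2, divided by
    \<open>H\<close>.\<close>
  define c0 where "c0 = g / (8 * real DIM('a))"
  define B where "B = (3 / 4) powr (2 / m) / (2::real)"
  have E: "0 < E" unfolding E_def powr_gt_zero by (smt (verit) powr_ge_zero)
  have k: "0 < k" using n by (simp add: k_def)
  have mk: "m * (k + 2) < k" using m n by (simp add: k_def field_simps)
  have m1: "m < 1"
  proof (rule ccontr)
    assume "\<not> m < 1"
    then have "1 * (k + 2) \<le> m * (k + 2)" using k by (intro mult_right_mono) auto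
    then show False using mk by simp
  qed
  \<comment> \<open>Here the range of \<open>m\<close> enters: m < (n-2)/n says exactly that k/m - 2
    exceeds k.\<close>
  have \<beta>: "k < \<beta>" using mk m by (simp add: \<beta>_def field_simps)
  have g: "0 < g" using n by (simp add: g_def)
  have c0: "0 < c0" using g n by (simp add: c0_def)
  have B: "0 < B" by (simp add: B_def)
  \<comment> \<open>\<open>A1\<close> is the largest amplitude that \<open>inner\<close> can support
    and \<open>A2\<close> the largest one for which the exterior function is a subsolution up to
    time \<open>T\<close>.\<close>
  define A1 where "A1 = B / (E * 4 powr (\<beta> + 2))"
  define A2 where "A2 = ((1 - m) * c0 * (\<beta> * (\<beta> - k)) / E) powr (1 / (1 - m))"
  define A where "A = min A1 A2"
  have base: "0 < (1 - m) * c0 * (\<beta> * (\<beta> - k)) / E" using m1 c0 k \<beta> E by simp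
  then have "0 < A1" "0 < A2" using B E by (auto simp: A1_def A2_def powr_gt_zero simp del: divide_eq_0_iff)
  then have A: "0 < A" by (simp add: A_def)
  have AB: "A * E * 4 powr (\<beta> + 2) \<le> B"
  proof -
    have "A * (E * 4 powr (\<beta> + 2)) \<le> A1 * (E * 4 powr (\<beta> + 2))"
      using E by (intro mult_right_mono) (auto simp: A_def)
    then show ?thesis using E by (simp add: A1_def mult_ac)
  qed
  have A2: "A powr (1 - m) * E \<le> (1 - m) * c0 * (\<beta> * (\<beta> - k))"
  proof -
    have "A powr (1 - m) \<le> A2 powr (1 - m)" using A m1 by (intro powr_mono2) (auto simp: A_def)
    also have "\<dots> = (1 - m) * c0 * (\<beta> * (\<beta> - k)) / E"
      using m1 unfolding A2_def powr_powr by (simp add: powr_one[OF less_imp_le[OF base]] del: powr_one' abs_divide)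
    finally show ?thesis using E by (simp add: field_simps)
  qed
  have split: "y powr (1 - m) * y powr m = y" if "0 < y" for y :: real
    using that by (simp add: powr_add[symmetric])
  show ?thesis
  proof (intro exI conjI allI impI)
    fix v :: "'a \<Rightarrow> real \<Rightarrow> real" and v0 \<epsilon> r H c x
    assume v: "positive_classical_solution m UNIV v" and at: "attains_initial_L1loc UNIV v v0"
      and eps: "0 < \<epsilon>" "\<forall>x. \<forall>t>0. \<epsilon> \<le> v x t" and r: "0 < r" and H: "0 < H"
      and v0: "AE x in lebesgue. x \<in> ball c r \<longrightarrow> H \<le> v0 x" and x: "r \<le> norm (x - c)"
    define T where "T = c0 * H powr (1 - m) * r\<^sup>2"
    have T: "0 < T" using c0 H r by (simp add: T_def)
    have TH: "T * H powr m = c0 * r\<^sup>2 * H"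
      using split[OF H] by (simp add: T_def mult_ac)
    have inner: "H * B \<le> v y t" if y: "norm (y - c) < r / 2" and t: "0 < t" "t \<le> T" for y t
    proof -
      have "8 * real DIM('a) * T * H powr m = 8 * real DIM('a) * (c0 * r\<^sup>2 * H)"
        unfolding TH[symmetric] by simp
      also have "\<dots> = H * g * r\<^sup>2" using n by (simp add: c0_def)
      finally have small: "8 * real DIM('a) * T * H powr m \<le> H * g * r\<^sup>2" by simp
      have yb: "y \<in> ball c r" using y r by (simp add: dist_norm norm_minus_commute)
      have low: "H / 2 * (1 - (norm (y - c))\<^sup>2 / r\<^sup>2) powr (2 / m) \<le> v y t"
        by (rule interior_lower_bound[OF m(1) v at eps(1) _ r H T v0 small[unfolded g_def] yb t])
          (use eps in auto)
      have "(norm (y - c))\<^sup>2 \<le> (r / 2)\<^sup>2" using y by (intro power_mono) auto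
      then have "3 / 4 \<le> 1 - (norm (y - c))\<^sup>2 / r\<^sup>2" using r by (simp add: field_simps power2_eq_square)
      then have "(3 / 4) powr (2 / m) \<le> (1 - (norm (y - c))\<^sup>2 / r\<^sup>2) powr (2 / m)"
        using m by (intro powr_mono2) auto
      then have "H / 2 * (3 / 4) powr (2 / m) \<le> H / 2 * (1 - (norm (y - c))\<^sup>2 / r\<^sup>2) powr (2 / m)"
        using H by (intro mult_left_mono) auto
      then show ?thesis using low by (simp add: B_def)
    qed
    have "H * A * E * r\<^sup>2 = r\<^sup>2 * H * A powr m * (A powr (1 - m) * E)"
      using split[OF A] by (simp add: mult_ac)
    also have "\<dots> \<le> r\<^sup>2 * H * A powr m * ((1 - m) * c0 * (\<beta> * (\<beta> - k)))"
      using A2 H by (intro mult_left_mono) auto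
    also have "\<dots> = (1 - m) * (\<beta> * (\<beta> - k)) * A powr m * (c0 * r\<^sup>2 * H)" by (simp add: mult_ac)
    also have "\<dots> = (1 - m) * T * (\<beta> * (\<beta> - k)) * (H powr m * A powr m)"
      unfolding TH[symmetric] by (simp add: mult_ac)
    finally have small: "H * A * E * r\<^sup>2 \<le> (1 - m) * T * (\<beta> * (\<beta> - k)) * (H powr m * A powr m)" .
    have "H * A * (norm (x - c) / r) powr (- (real DIM('a) - 2) / m) \<le> v x T"
      by (rule exterior_lower_bound[OF m(1) m1 k[unfolded k_def] _ v eps(1) _ r H T A inner])
        (use eps AB small x \<beta> in \<open>simp_all add: E_def \<beta>_def k_def\<close>)
    then show "H * A * (norm (x - c) / r) powr (- (real DIM('a) - 2) / m) \<le> v x (c0 * H powr (1 - m) * r\<^sup>2)"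
      by (simp add: T_def)
  qed (use c0 A in auto)
qed

lemma powr_at_top:
  assumes "0 < (p::real)"
  shows "filterlim (\<lambda>x::real. x powr p) at_top at_top"
proof -
  have "filterlim (\<lambda>x::real. exp (p * ln x)) at_top at_top"
    by (intro filterlim_compose[OF exp_at_top] filterlim_tendsto_pos_mult_at_top[OF tendsto_const assms] ln_at_top)
  moreover have "\<forall>\<^sub>F x::real in at_top. exp (p * ln x) = x powr p"
    using eventually_gt_at_top[of 0] by eventually_elim (simp add: powr_def)
  ultimately show ?thesis by (rule filterlim_cong[THEN iffD1, OF refl refl, rotated])
qed

subsection \<open>Large time behaviour\<close>

theorem theorem1p9:
  fixes a :: "nat \<Rightarrow> real ^ 'n"
    and i0 :: nat
    and m \<mu>0 p \<delta>1 :: real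
    and lam \<gamma> :: "nat \<Rightarrow> real"
    and u0 :: "real ^ 'n \<Rightarrow> real"
    and u :: "real ^ 'n \<Rightarrow> real \<Rightarrow> real"
  assumes "CARD('n) \<ge> 3"
    and "0 < m" and "m < (real CARD('n) - 2) / real CARD('n)"
    and "\<mu>0 > 0"
    and "i0 \<ge> 1" and "inj_on a {1..i0}"
    and "p > real CARD('n) * (1 - m) / 2"
    and "Lp_loc p (punctured a i0) u0"
    and "AE x in lebesgue. x \<in> punctured a i0 \<longrightarrow> \<mu>0 \<le> u0 x"
    and "0 < \<delta>1" and "ereal \<delta>1 < delta0 a i0"
    and "\<forall>i\<in>{1..i0}. lam i > 0"
    and "\<gamma> 1 > (real CARD('n) - 2) / m"
    and "\<forall>i\<in>{2..i0}. \<gamma> i > 2 / (1 - m)"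
    and "\<forall>i\<in>{1..i0}. AE x in lebesgue.
           0 < norm (x - a i) \<and> norm (x - a i) < \<delta>1 \<longrightarrow> u0 x \<ge> lam i / norm (x - a i) powr \<gamma> i"
    and "constructed_solution m a i0 u0 u"
  shows "\<forall>K. compact K \<and> K \<subseteq> punctured a i0 \<longrightarrow>
           (\<forall>B. \<forall>\<^sub>F t in at_top. \<forall>x\<in>K. B < u x t)"
proof (intro allI impI)
  fix K B assume K: "compact K \<and> K \<subseteq> punctured a i0"
  define n where "n = real CARD('n)"
  define k where "k = n - 2"
  define c where "c = a 1"
  define l where "l = lam 1"
  define s where "s = \<gamma> 1"
  have one: "1 \<in> {1..i0}" using assms(5) by simp
  have l: "0 < l" using assms(12) one by (simp add: l_def)
  have k: "0 < k" using assms(1) by (simp add: k_def n_def)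
  have m: "0 < m" "m * (k + 2) < k" using assms(1-3) by (simp_all add: k_def n_def field_simps)
  have m1: "m < 1"
  proof (rule ccontr)
    assume "\<not> m < 1"
    then have "1 * (k + 2) \<le> m * (k + 2)" using k by (intro mult_right_mono) auto
    then show False using m by simp
  qed
  have s: "k / m < s" using assms(13) by (simp add: s_def k_def n_def)
  have spos: "0 < s" using s k m(1) by (meson divide_pos_pos order_less_trans)
  \<comment> \<open>With H = l r^(-s), the time c0 H^(1-m) r^2 equals c1 r^(-\<sigma>), so it tends
    to infinity as r tends to 0 once \<sigma> is positive.\<close>
  define \<sigma> where "\<sigma> = s * (1 - m) - 2"
  have \<sigma>: "0 < \<sigma>"
  proof -
    have "2 < k / m * (1 - m)" using m by (simp add: field_simps)
    also have "\<dots> < s * (1 - m)" using s m1 by (intro mult_strict_right_mono) auto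
    finally show ?thesis by (simp add: \<sigma>_def)
  qed
  have u0: "AE x in lebesgue. 0 < norm (x - c) \<and> norm (x - c) < \<delta>1 \<longrightarrow> u0 x \<ge> l / norm (x - c) powr s"
    using assms(15) one by (auto simp: c_def l_def s_def)
  obtain U V where
    U: "\<And>\<epsilon> M. 0 < \<epsilon> \<Longrightarrow> \<epsilon> < 1 \<Longrightarrow> 1 < M \<Longrightarrow> approx_solution m u0 \<epsilon> M (U \<epsilon> M)"
    and V: "\<And>x t M. x \<in> punctured a i0 \<Longrightarrow> 0 < t \<Longrightarrow> 1 < M \<Longrightarrow> ((\<lambda>\<epsilon>. U \<epsilon> M x t) \<longlongrightarrow> V M x t) (at_right 0)"
    and Vu: "\<And>x t. x \<in> punctured a i0 \<Longrightarrow> 0 < t \<Longrightarrow> ((\<lambda>M. V M x t) \<longlongrightarrow> u x t) at_top"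
    using assms(16) unfolding constructed_solution_def by blast
  have dim: "3 \<le> DIM(real ^ 'n)" "m < (real DIM(real ^ 'n) - 2) / real DIM(real ^ 'n)"
    using assms(1,3) by simp_all
  have kD: "real DIM(real ^ 'n) - 2 = k" by (simp add: k_def n_def)
  obtain c0 A where c0: "0 < c0" and A: "0 < A" and spread:
    "\<forall>(v::real ^ 'n \<Rightarrow> real \<Rightarrow> real) v0 \<epsilon> r H c.
      positive_classical_solution m UNIV v \<longrightarrow> attains_initial_L1loc UNIV v v0 \<longrightarrow>
      0 < \<epsilon> \<longrightarrow> (\<forall>x. \<forall>t>0. \<epsilon> \<le> v x t) \<longrightarrow> 0 < r \<longrightarrow> 0 < H \<longrightarrow>
      (AE x in lebesgue. x \<in> ball c r \<longrightarrow> H \<le> v0 x) \<longrightarrow>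
      (\<forall>x. r \<le> norm (x - c) \<longrightarrow>
        H * A * (norm (x - c) / r) powr (- k / m) \<le> v x (c0 * H powr (1 - m) * r\<^sup>2))"
    using source_spreads[OF dim(1) m(1) dim(2), unfolded kD] by (elim exE conjE) (rule that)
  have "c \<notin> K" using K one by (auto simp: punctured_def c_def)
  then obtain d where d: "0 < d" "\<And>x. x \<in> K \<Longrightarrow> d \<le> norm (x - c)"
    using separate_point_closed[of K c] K by (auto simp: compact_imp_closed dist_norm norm_minus_commute)
  obtain R where R: "0 < R" "\<And>x. x \<in> K \<Longrightarrow> norm (x - c) \<le> R"
  proof -
    have "bounded ((\<lambda>x. x - c) ` K)"
      using K by (intro compact_imp_bounded compact_continuous_image) (auto intro!: continuous_intros)
    then show thesis using that unfolding bounded_pos by auto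
  qed
  define c1 where "c1 = c0 * l powr (1 - m)"
  have c1: "0 < c1" using c0 l by (simp add: c1_def)
  \<comment> \<open>\<open>r t\<close> solves c1 r^(-\<sigma>) = t. \<open>Z t\<close> is the
    exterior bound H A (R/r)^(-k/m) at this radius, with \<open>R\<close> the largest distance
    allowed on \<open>K\<close>; its exponent in t is positive because s > k/m.\<close>
  define r where "r = (\<lambda>t. (t / c1) powr (- (1 / \<sigma>)))"
  define Z where "Z = (\<lambda>t. l * A * R powr (- k / m) * (t / c1) powr ((s - k / m) / \<sigma>))"
  have tc: "filterlim (\<lambda>t. t / c1) at_top at_top"
    using filterlim_tendsto_pos_mult_at_top[OF tendsto_const _ filterlim_ident, of "1 / c1"] c1 by simp
  have "(r \<longlongrightarrow> 0) at_top" unfolding r_def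
    by (rule tendsto_neg_powr[OF _ tc]) (use \<sigma> in simp)
  \<comment> \<open>Below \<open>\<delta>1\<close> the lower bound on the initial value holds
    throughout the ball, and below \<open>d\<close> the set \<open>K\<close> lies in its
    exterior.\<close>
  then have "\<forall>\<^sub>F t in at_top. r t < min \<delta>1 d"
    by (rule order_tendstoD(2)) (use assms(10) d in simp)
  moreover have "\<forall>\<^sub>F t in at_top. B < Z t"
  proof -
    have "filterlim (\<lambda>t. (t / c1) powr ((s - k / m) / \<sigma>)) at_top at_top"
      by (rule filterlim_compose[OF powr_at_top tc]) (use s \<sigma> in simp)
    then have "filterlim Z at_top at_top" unfolding Z_def
      by (intro filterlim_tendsto_pos_mult_at_top[OF tendsto_const]) (use l A R in simp_all)
    then show ?thesis by (simp add: filterlim_at_top_dense)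
  qed
  ultimately show "\<forall>\<^sub>F t in at_top. \<forall>x\<in>K. B < u x t"
    using eventually_gt_at_top[of 0]
  proof eventually_elim
    case (elim t)
    have rt: "0 < r t" "r t < \<delta>1" "r t < d" using elim c1 by (auto simp: r_def)
    define H where "H = l * r t powr (- s)"
    have H: "0 < H" using l rt by (simp add: H_def)
    have time: "c0 * H powr (1 - m) * (r t)\<^sup>2 = t"
    proof -
      have "c0 * H powr (1 - m) * (r t)\<^sup>2 = c1 * (r t powr (- s * (1 - m)) * r t powr 2)"
        using l rt by (simp add: H_def c1_def powr_mult powr_powr)
      also have "r t powr (- s * (1 - m)) * r t powr 2 = r t powr (- \<sigma>)"
        by (simp add: powr_add[symmetric] \<sigma>_def)
      also have "\<dots> = t / c1" using \<sigma> elim c1 by (simp add: r_def powr_powr)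
      finally show ?thesis using c1 by simp
    qed
    have lower: "Z t \<le> U \<epsilon> M x t" if x: "x \<in> K" and eps: "0 < \<epsilon>" "\<epsilon> < 1" and M: "1 < M" "H \<le> M" for x \<epsilon> M
    proof -
      have ap: "approx_solution m u0 \<epsilon> M (U \<epsilon> M)" by (rule U[OF eps M(1)])
      \<comment> \<open>The growth condition on \<open>u0\<close> is stated off the center, which is
        a null set. The truncation is harmless because \<open>H \<le> M\<close>.\<close>
      have "AE y in lebesgue. y \<notin> {c}"
        by (rule AE_not_in) (simp flip: negligible_iff_null_sets)
      then have v0: "AE y in lebesgue. y \<in> ball c (r t) \<longrightarrow> H \<le> min (u0 y) M + \<epsilon>"
        using u0
      proof eventually_elim
        case (elim y)
        show ?case
        proof
          assume "y \<in> ball c (r t)"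
          then have y: "0 < norm (y - c)" "norm (y - c) < r t"
            using elim by (auto simp: dist_norm norm_minus_commute)
          have "H = l / r t powr s" by (simp add: H_def powr_minus divide_inverse)
          also have "\<dots> \<le> l / norm (y - c) powr s"
            using y l spos rt by (intro divide_left_mono powr_mono2 mult_pos_pos) auto
          also have "\<dots> \<le> u0 y" using elim y rt by auto
          finally show "H \<le> min (u0 y) M + \<epsilon>" using M eps by simp
        qed
      qed
      have "H * A * (norm (x - c) / r t) powr (- k / m) \<le> U \<epsilon> M x (c0 * H powr (1 - m) * (r t)\<^sup>2)"
        by (rule spread[rule_format, OF _ _ eps(1) _ rt(1) H v0])
          (use ap d(2)[OF x] rt in \<open>auto simp: approx_solution_def\<close>)
      moreover have "Z t \<le> H * A * (norm (x - c) / r t) powr (- k / m)"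
      proof -
        have "r t powr (- (s - k / m)) = (t / c1) powr ((s - k / m) / \<sigma>)"
          unfolding r_def powr_powr by (rule arg_cong[where f = "\<lambda>e. (t / c1) powr e"])
            (simp only: minus_mult_minus times_divide_eq_left mult_1_left)
        then have "Z t = l * A * R powr (- k / m) * r t powr (- (s - k / m))"
          by (simp only: Z_def)
        also have "r t powr (- (s - k / m)) = r t powr (- s) * r t powr (k / m)"
          by (simp add: powr_add[symmetric])
        also have "R powr (- k / m) \<le> norm (x - c) powr (- k / m)"
          using R(2)[OF x] d(1) d(2)[OF x] k m by (intro powr_mono2') auto
        then have "l * A * R powr (- k / m) * (r t powr (- s) * r t powr (k / m)) \<le>
            l * A * norm (x - c) powr (- k / m) * (r t powr (- s) * r t powr (k / m))"
          using l A by (intro mult_right_mono mult_left_mono) auto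
        also have "\<dots> = H * A * (norm (x - c) / r t) powr (- k / m)"
        proof -
          have "(norm (x - c) / r t) powr (- k / m) = norm (x - c) powr (- k / m) / r t powr (- k / m)"
            using rt by (intro powr_divide)
          also have "\<dots> = norm (x - c) powr (- k / m) * r t powr (k / m)"
            by (simp add: powr_minus divide_inverse[of "inverse _"])
          finally show ?thesis by (simp add: H_def)
        qed
        finally show ?thesis .
      qed
      ultimately show ?thesis using time by simp
    qed
    show ?case
    proof
      fix x assume x: "x \<in> K"
      then have xp: "x \<in> punctured a i0" using K by blast
      \<comment> \<open>The bound \<open>Z t\<close> does not involve \<open>\<epsilon>\<close>,
        \<open>M\<close> or the point of \<open>K\<close>, so it survives both limits and is uniform
        on \<open>K\<close>.\<close>
      have "Z t \<le> V M x t" if M: "1 < M" "H \<le> M" for M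
      proof (rule tendsto_lowerbound[OF V[OF xp _ M(1)]])
        have "\<forall>\<^sub>F \<epsilon> in at_right (0::real). \<epsilon> \<in> {0<..<1}" by (rule eventually_at_right_real) simp
        then show "\<forall>\<^sub>F \<epsilon> in at_right 0. Z t \<le> U \<epsilon> M x t"
          by eventually_elim (use lower[OF x] M in auto)
      qed (use elim in auto)
      note VZ = this
      have "\<forall>\<^sub>F M in at_top. Z t \<le> V M x t"
        using eventually_gt_at_top[of 1] eventually_ge_at_top[of H] by eventually_elim (rule VZ)
      then have "Z t \<le> u x t"
        using tendsto_lowerbound[OF Vu[OF xp]] elim by auto
      then show "B < u x t" using elim by simp
    qed
  qed
qed

end
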